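(* Fix an integer $n\ge1$ and $0\le\lambda<1$, and for real $t$ let $$\sigma_{n,t,\lambda}=\frac{|0\rangle\langle0|+t^2|n\rangle\langle n|+\lambda t\,(|0\rangle\langle n|+|n\rangle\langle0|)}{1+t^2}.$$ There is a $t_0=t_0(n,\lambda)>0$ such that $W_{\sigma_{n,t,\lambda}}>0$ everywhere on $\mathbb R^2$ for $|t|\le t_0$. Moreover, $$h(W_{\sigma_{n,t,\lambda}})-(1+\ln\pi)=(2n-2^n\lambda^2)t^2+O_{n,\lambda}(t^4),\qquad t\to0.$$ Consequently, for every $n\ge3$ and every $\lambda$ with $\sqrt{n/2^{n-1}}<\lambda<1$, all sufficiently small nonzero $t$ satisfy $W_{\sigma_{n,t,\lambda}}>0$ everywhere and $h(W_{\sigma_{n,t,\lambda}})<1+\ln\pi$.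
   Context: One bosonic mode on $L^2(\mathbb R)$ with $[\hat q,\hat p]=i$, $\hat a=(\hat q+i\hat p)/\sqrt2$; $|n\rangle$ are the Fock (number) states, $|n\rangle=(\hat a^\dagger)^n|0\rangle/\sqrt{n!}$ with $\hat a|0\rangle=0$. The Wigner function of a density operator is $W_\rho(q,p)=\frac1\pi\int_{\mathbb R}e^{2ipy}\langle q-y|\rho|q+y\rangle\,dy$. For $W_\rho\ge0$, $h(W_\rho)=-\int_{\mathbb R^2}W_\rho\ln W_\rho\,dq\,dp$ (natural logarithm); the vacuum has $h=1+\ln\pi$. $O_{n,\lambda}$ means the implied constant may depend on $n$ and $\lambda$. *)

theory Defs
  imports "HOL-Probability.Probability" "HOL-Library.Landau_Symbols"
begin

text \<open>Position-space wave functions are functions \<open>real \<Rightarrow> complex\<close>. The unbounded operators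
  are given by their action on differentiable representatives.\<close>

definition position_op :: "(real \<Rightarrow> complex) \<Rightarrow> real \<Rightarrow> complex" where
  "position_op f = (\<lambda>x. complex_of_real x * f x)"

definition momentum_op :: "(real \<Rightarrow> complex) \<Rightarrow> real \<Rightarrow> complex" where
  "momentum_op f = (\<lambda>x. - \<i> * vector_derivative f (at x))"

definition annihilation :: "(real \<Rightarrow> complex) \<Rightarrow> real \<Rightarrow> complex" where
  "annihilation f = (\<lambda>x. (position_op f x + \<i> * momentum_op f x) / complex_of_real (sqrt 2))"

definition creation :: "(real \<Rightarrow> complex) \<Rightarrow> real \<Rightarrow> complex" where
  "creation f = (\<lambda>x. (position_op f x - \<i> * momentum_op f x) / complex_of_real (sqrt 2))"

text \<open>The lemmas \<open>annihilation_vacuum\<close>, \<open>vacuum_normalised\<close> and \<open>vacuum_unique\<close> below show that this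
  is the normalised solution of \<open>annihilation f = 0\<close>, unique up to a constant phase; a phase would
  multiply every Fock state and drop out of all density operators.\<close>

definition vacuum :: "real \<Rightarrow> complex" where
  "vacuum = (\<lambda>x. complex_of_real (pi powr (- (1/4)) * exp (- x\<^sup>2 / 2)))"

definition fock :: "nat \<Rightarrow> real \<Rightarrow> complex" where
  "fock n = (\<lambda>x. (creation ^^ n) vacuum x / complex_of_real (sqrt (fact n)))"

definition braket :: "(real \<Rightarrow> complex) \<Rightarrow> (real \<Rightarrow> complex) \<Rightarrow> complex" where
  "braket f g = (LINT x|lborel. cnj (f x) * g x)"

text \<open>An operator \<open>A\<close> is represented by its position-space kernel \<open>\<lambda>x y. \<langle>x|A|y\<rangle>\<close>.\<close>

type_synonym kernel = "real \<Rightarrow> real \<Rightarrow> complex"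

definition ketbra :: "(real \<Rightarrow> complex) \<Rightarrow> (real \<Rightarrow> complex) \<Rightarrow> kernel" where
  "ketbra f g = (\<lambda>x y. f x * cnj (g y))"

definition kernel_apply :: "kernel \<Rightarrow> (real \<Rightarrow> complex) \<Rightarrow> real \<Rightarrow> complex" where
  "kernel_apply K f = (\<lambda>x. LINT y|lborel. K x y * f y)"

text \<open>The integral is real for Hermitian kernels (lemma \<open>of_real_wigner\<close>), so that taking the real
  part only changes the type.\<close>

definition wigner :: "kernel \<Rightarrow> real \<Rightarrow> real \<Rightarrow> real" where
  "wigner K q p =
     Re (1 / complex_of_real pi *
         (LINT y|lborel. exp (2 * \<i> * complex_of_real p * complex_of_real y) * K (q - y) (q + y)))"

definition diff_entropy :: "(real \<Rightarrow> real \<Rightarrow> real) \<Rightarrow> real" where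
  "diff_entropy W = - (LINT z|(lborel :: (real \<times> real) measure).
                         W (fst z) (snd z) * ln (W (fst z) (snd z)))"

definition sigma_state :: "nat \<Rightarrow> real \<Rightarrow> real \<Rightarrow> kernel" where
  "sigma_state n t l = (\<lambda>x y.
     (ketbra (fock 0) (fock 0) x y
      + complex_of_real (t\<^sup>2) * ketbra (fock n) (fock n) x y
      + complex_of_real (l * t) * (ketbra (fock 0) (fock n) x y + ketbra (fock n) (fock 0) x y))
     / complex_of_real (1 + t\<^sup>2))"


lemma canonical_commutation:
  assumes "f differentiable (at x)"
  shows "position_op (momentum_op f) x - momentum_op (position_op f) x = \<i> * f x"
proof -
  have f: "(f has_vector_derivative vector_derivative f (at x)) (at x)"
    using assms by (simp add: vector_derivative_works)
  have "((\<lambda>x. complex_of_real x * f x) has_vector_derivative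
          (complex_of_real x * vector_derivative f (at x) + complex_of_real 1 * f x)) (at x)"
    by (rule has_vector_derivative_mult[OF _ f]) (rule has_vector_derivative_of_real[OF DERIV_ident])
  then have "vector_derivative (\<lambda>x. complex_of_real x * f x) (at x)
      = complex_of_real x * vector_derivative f (at x) + f x"
    by (simp add: vector_derivative_at)
  then show ?thesis
    by (simp add: position_op_def momentum_op_def algebra_simps)
qed

lemma vacuum_has_vector_derivative:
  "(vacuum has_vector_derivative - complex_of_real x * vacuum x) (at x)"
proof -
  have "((\<lambda>x. pi powr (- (1/4)) * exp (- x\<^sup>2 / 2)) has_real_derivative
          - x * (pi powr (- (1/4)) * exp (- x\<^sup>2 / 2))) (at x)"
    by (auto intro!: derivative_eq_intros)
  from has_vector_derivative_of_real[OF this] show ?thesis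
    by (simp add: vacuum_def)
qed

lemma annihilation_vacuum: "annihilation vacuum = (\<lambda>x. 0)"
  by (simp add: annihilation_def position_op_def momentum_op_def fun_eq_iff
      vector_derivative_at[OF vacuum_has_vector_derivative])

lemma vacuum_normalised: "braket vacuum vacuum = 1"
proof -
  have "cnj (vacuum x) * vacuum x = complex_of_real (normal_density 0 (1 / sqrt 2) x)" for x
  proof -
    have "pi powr (- (1/4)) * pi powr (- (1/4)) = 1 / sqrt pi"
      by (simp add: powr_add[symmetric] powr_minus powr_half_sqrt field_simps)
    moreover have "exp (- x\<^sup>2 / 2) * exp (- x\<^sup>2 / 2) = exp (- x\<^sup>2)"
      by (simp add: exp_add[symmetric])
    ultimately have "(pi powr (- (1/4)) * exp (- x\<^sup>2 / 2)) * (pi powr (- (1/4)) * exp (- x\<^sup>2 / 2))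
        = 1 / sqrt pi * exp (- x\<^sup>2)"
      by (metis mult.assoc mult.left_commute)
    then show ?thesis
      unfolding vacuum_def complex_cnj_complex_of_real of_real_mult[symmetric]
      by (simp add: normal_density_def power_divide)
  qed
  then show ?thesis
    by (simp add: braket_def)
qed

lemma vacuum_unique:
  assumes "\<And>x. f differentiable (at x)" "annihilation f = (\<lambda>x. 0)"
  shows "\<exists>c. \<forall>x. f x = c * vacuum x"
proof -
  have f: "(f has_vector_derivative - complex_of_real x * f x) (at x)" for x
  proof -
    have "complex_of_real x * f x + vector_derivative f (at x) = 0"
      using fun_cong[OF assms(2), of x]
      by (simp add: annihilation_def position_op_def momentum_op_def)
    then have "vector_derivative f (at x) = - complex_of_real x * f x"
      by (simp add: add_eq_0_iff)
    then show ?thesis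
      using assms(1)[of x] by (metis vector_derivative_works)
  qed
  define g where "g = (\<lambda>x. complex_of_real (exp (x\<^sup>2 / 2)) * f x)"
  have "(g has_vector_derivative 0) (at x)" for x
  proof -
    have "((\<lambda>x. exp (x\<^sup>2 / 2)) has_real_derivative x * exp (x\<^sup>2 / 2)) (at x)"
      by (auto intro!: derivative_eq_intros)
    from has_vector_derivative_mult[OF has_vector_derivative_of_real[OF this] f]
    show ?thesis by (simp add: g_def algebra_simps)
  qed
  then obtain c where c: "\<And>x. g x = c"
    using has_vector_derivative_zero_constant[of UNIV g] by (metis UNIV_I convex_UNIV)
  have "f x = (c / complex_of_real (pi powr (- (1/4)))) * vacuum x" for x
    using c[of x] by (auto simp: g_def vacuum_def exp_minus field_simps)
  then show ?thesis by blast
qed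

lemma kernel_apply_ketbra: "kernel_apply (ketbra f g) h = (\<lambda>x. f x * braket g h)"
  by (simp add: kernel_apply_def ketbra_def braket_def mult.assoc)

lemma of_real_wigner:
  assumes "\<And>x y. K y x = cnj (K x y)"
  shows "complex_of_real (wigner K q p) =
     1 / complex_of_real pi *
       (LINT y|lborel. exp (2 * \<i> * complex_of_real p * complex_of_real y) * K (q - y) (q + y))"
proof -
  define F where
    "F = (\<lambda>y. exp (2 * \<i> * complex_of_real p * complex_of_real y) * K (q - y) (q + y))"
  have "cnj (F y) = F (- y)" for y
    using assms[of "q - y" "q + y"] by (simp add: F_def exp_cnj)
  then have "cnj (integral\<^sup>L lborel F) = (LINT y|lborel. F (0 + (- 1) * y))"
    by (simp add: Bochner_Integration.integral_cnj[symmetric] del: Bochner_Integration.integral_cnj)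
  also have "\<dots> = integral\<^sup>L lborel F"
    using lborel_integral_real_affine[of "- 1" F 0] by simp
  finally have "integral\<^sup>L lborel F \<in> \<real>"
    by (simp add: Reals_cnj_iff)
  then show ?thesis
    unfolding wigner_def F_def[symmetric] by (intro of_real_Re) auto
qed

lemma sigma_state_hermitian: "sigma_state n t l y x = cnj (sigma_state n t l x y)"
  by (simp add: sigma_state_def ketbra_def algebra_simps)

end

theory Submission
  imports Defs "HOL-Real_Asymp.Real_Asymp"
begin

text \<open>Relative to the vacuum Gaussian \<open>\<mu> = exp (- r\<^sup>2) / \<pi>\<close> the Wigner function of the state is
  \<open>\<mu> (1 + u) / (1 + t\<^sup>2)\<close> with \<open>u = \<lambda> t C + t\<^sup>2 L\<close>, where \<open>C\<close> is a multiple of \<open>Re (z ^ n)\<close> and \<open>L\<close> is a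
  Laguerre polynomial in \<open>r\<^sup>2\<close>. The entropy is then explicit up to the \<open>\<mu>\<close>-integral of \<open>(1 + u) ln (1 + u)\<close>,
  and \<open>0 \<le> (1 + u) ln (1 + u) - (u + u\<^sup>2 / 2 - u ^ 3 / 6) \<le> u ^ 4 / 3\<close> holds for all \<open>u > -1\<close>, so no
  truncation of the plane is needed. The moments of \<open>u\<close> follow from \<open>\<integral> z ^ a * cnj z ^ b d\<mu> = a!\<close> if \<open>a = b\<close>
  and \<open>0\<close> otherwise; in particular the integrals of \<open>C\<close>, \<open>C L\<close> and \<open>C ^ 3\<close> vanish, which removes
  the odd orders \<open>t\<close> and \<open>t ^ 3\<close>.\<close>

section \<open>Functions of polynomial growth and one-dimensional Gaussian integrals\<close>

text \<open>The obstacle is that small \<open>t\<close> does not make \<open>u\<close> uniformly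
  small: at radius of order |t|^(-1/n) the terms 1, \<open>l t C\<close> and \<open>t^2 L\<close>
  are of comparable size, so a Taylor expansion of the logarithm cannot be applied pointwise there.
  In that range positivity comes from completing a square, which is where \<open>l < 1\<close>
  enters. The coefficient has two sources. The expectation of r^2 rises from the vacuum value 1 to
  (1 + (2n+1) t^2) / (1 + t^2), an excess of 2n t^2 to leading order. Half the second moment of
  \<open>l t C\<close> is 2^n l^2 t^2, and it lowers the entropy. The mean t^2 of \<open>u\<close>
  also enters the integral of (1 + u) ln (1 + u), but at this order it cancels against the
  normalisation term ln (1 + t^2). The coefficient is negative exactly when l^2 > n / 2^(n-1); this
  quotient is 1 for n = 1 and n = 2 and drops below 1 from n = 3 on.\<close>

definition poly_growth :: "('a::real_normed_vector \<Rightarrow> 'b::real_normed_vector) \<Rightarrow> bool" where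
  "poly_growth f \<longleftrightarrow> f \<in> borel_measurable borel \<and> (\<exists>C k. \<forall>z. norm (f z) \<le> C * (1 + norm z) ^ k)"

lemma poly_growthI:
  "f \<in> borel_measurable borel \<Longrightarrow> (\<And>z. norm (f z) \<le> C * (1 + norm z) ^ k) \<Longrightarrow> poly_growth f"
  unfolding poly_growth_def by blast

lemma poly_growth_measurable [measurable_dest]:
  "poly_growth f \<Longrightarrow> f \<in> borel_measurable borel"
  by (simp add: poly_growth_def)

lemma poly_growthD:
  assumes "poly_growth f"
  shows "\<exists>C k. 0 \<le> C \<and> (\<forall>z. norm (f z) \<le> C * (1 + norm z) ^ k)"
proof -
  from assms obtain C k where C: "\<And>z. norm (f z) \<le> C * (1 + norm z) ^ k"
    by (auto simp: poly_growth_def)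
  have "0 \<le> C" using C[of 0] order_trans[OF norm_ge_zero] by fastforce
  with C show ?thesis by blast
qed

lemma poly_growth_dominated:
  assumes "f \<in> borel_measurable borel" "poly_growth g" "\<And>z. norm (f z) \<le> norm (g z)"
  shows "poly_growth f"
proof -
  obtain C k where "\<And>z. norm (g z) \<le> C * (1 + norm z) ^ k"
    using poly_growthD[OF assms(2)] by blast
  with assms(3) have "norm (f z) \<le> C * (1 + norm z) ^ k" for z by (meson order_trans)
  with assms(1) show ?thesis by (rule poly_growthI)
qed

lemma poly_growth_const [intro, simp]: "poly_growth (\<lambda>_. c)"
  by (rule poly_growthI[of _ "norm c" 0]) auto

lemma poly_growth_add [intro]:
  fixes f g :: "'a::real_normed_vector \<Rightarrow> 'b::{real_normed_vector, second_countable_topology}"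
  assumes f: "poly_growth f" and g: "poly_growth g"
  shows "poly_growth (\<lambda>z. f z + g z)"
proof -
  obtain C k where C: "0 \<le> C" "\<And>z. norm (f z) \<le> C * (1 + norm z) ^ k" using poly_growthD[OF f] by blast
  obtain D l where D: "0 \<le> D" "\<And>z. norm (g z) \<le> D * (1 + norm z) ^ l" using poly_growthD[OF g] by blast
  have "norm (f z + g z) \<le> (C + D) * (1 + norm z) ^ max k l" for z
  proof -
    have "C * (1 + norm z) ^ k \<le> C * (1 + norm z) ^ max k l"
      using C(1) by (intro mult_left_mono power_increasing) auto
    moreover have "D * (1 + norm z) ^ l \<le> D * (1 + norm z) ^ max k l"
      using D(1) by (intro mult_left_mono power_increasing) auto
    ultimately show ?thesis
      using norm_triangle_ineq[of "f z" "g z"] C(2)[of z] D(2)[of z]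
      by (simp add: distrib_right)
  qed
  moreover have "(\<lambda>z. f z + g z) \<in> borel_measurable borel"
    using f g by (intro borel_measurable_add poly_growth_measurable)
  ultimately show ?thesis by (rule poly_growthI[rotated])
qed

lemma poly_growth_mult [intro]:
  fixes f g :: "'a::real_normed_vector \<Rightarrow> 'b::{real_normed_algebra, second_countable_topology}"
  assumes f: "poly_growth f" and g: "poly_growth g"
  shows "poly_growth (\<lambda>z. f z * g z)"
proof -
  obtain C k where C: "0 \<le> C" "\<And>z. norm (f z) \<le> C * (1 + norm z) ^ k" using poly_growthD[OF f] by blast
  obtain D l where D: "0 \<le> D" "\<And>z. norm (g z) \<le> D * (1 + norm z) ^ l" using poly_growthD[OF g] by blast
  have "norm (f z * g z) \<le> (C * D) * (1 + norm z) ^ (k + l)" for z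
  proof -
    have "norm (f z) * norm (g z) \<le> (C * (1 + norm z) ^ k) * (D * (1 + norm z) ^ l)"
      using C D by (intro mult_mono) auto
    then show ?thesis
      using norm_mult_ineq[of "f z" "g z"] by (simp add: power_add mult_ac)
  qed
  moreover have "(\<lambda>z. f z * g z) \<in> borel_measurable borel"
    using f g by (intro borel_measurable_times poly_growth_measurable)
  ultimately show ?thesis by (rule poly_growthI[rotated])
qed

lemma poly_growth_power [intro]:
  fixes f :: "'a::real_normed_vector \<Rightarrow> 'b::{real_normed_algebra_1, second_countable_topology}"
  shows "poly_growth f \<Longrightarrow> poly_growth (\<lambda>z. f z ^ n)"
  by (induction n) auto

lemma poly_growth_sum [intro]:
  fixes f :: "'i \<Rightarrow> 'a::real_normed_vector \<Rightarrow> 'b::{real_normed_vector, second_countable_topology}"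
  shows "(\<And>i. i \<in> I \<Longrightarrow> poly_growth (f i)) \<Longrightarrow> poly_growth (\<lambda>z. \<Sum>i\<in>I. f i z)"
  by (induction I rule: infinite_finite_induct) auto

lemma poly_growth_norm_bound:
  assumes "f \<in> borel_measurable borel" "\<And>z. norm (f z) \<le> norm z"
  shows "poly_growth f"
  using assms(1)
proof (rule poly_growthI)
  show "norm (f z) \<le> 1 * (1 + norm z) ^ 1" for z using assms(2)[of z] by simp
qed

lemma poly_growth_poly:
  fixes f :: "'a::real_normed_vector \<Rightarrow> 'b::{real_normed_field, second_countable_topology}"
  assumes "poly_growth f"
  shows "poly_growth (\<lambda>z. poly P (f z))"
  using assms by (induction P) auto

section \<open>Gaussian domination and integrability on the line and the plane\<close>

lemma power_le_fact_exp:
  fixes x :: real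
  assumes "0 \<le> x"
  shows "x ^ k \<le> fact k * exp x"
proof -
  have "(\<lambda>n. x ^ n /\<^sub>R fact n) sums exp x" by (rule exp_converges)
  then have "(\<Sum>n\<in>{k}. x ^ n /\<^sub>R fact n) \<le> exp x"
    unfolding sums_iff using assms by (metis (no_types, lifting) finite.emptyI finite.insertI
        fact_ge_zero inverse_nonnegative_iff_nonnegative scaleR_nonneg_nonneg sum_le_suminf zero_le_power)
  then show ?thesis by (simp add: field_simps)
qed

text \<open>Half of the Gaussian pays for the polynomial. The other half is still integrable and
  still tends to 0 at infinity, which are the two uses of the bound.\<close>

lemma poly_growth_gauss_bound:
  assumes "poly_growth f"
  shows "\<exists>C. \<forall>z. norm (f z) * exp (- (norm z)\<^sup>2) \<le> C * exp (- (norm z)\<^sup>2 / 2)"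
proof -
  obtain C k where C: "0 \<le> C" "\<And>z. norm (f z) \<le> C * (1 + norm z) ^ k" using poly_growthD[OF assms] by blast
  have "norm (f z) * exp (- (norm z)\<^sup>2) \<le> (C * fact k * exp (3/2)) * exp (- (norm z)\<^sup>2 / 2)" for z
  proof -
    \<comment> \<open>Expanding \<open>(norm z - 1)^2 \<ge> 0\<close> trades the linear exponent for
      half of a quadratic one; 3/2 is 1 + 1/2.\<close>
    have "1 + norm z \<le> 3/2 + (norm z)\<^sup>2 / 2"
      using zero_le_power2[of "norm z - 1"] by (simp add: power2_diff)
    then have "(1 + norm z) ^ k \<le> fact k * exp (3/2 + (norm z)\<^sup>2 / 2)"
      using power_le_fact_exp[of "1 + norm z" k]
      by (smt (verit) exp_le_cancel_iff fact_ge_zero mult_left_mono norm_ge_zero)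
    then have "norm (f z) \<le> C * (fact k * exp (3/2 + (norm z)\<^sup>2 / 2))"
      using C by (meson mult_left_mono order_trans)
    then have "norm (f z) * exp (- (norm z)\<^sup>2)
        \<le> C * (fact k * exp (3/2 + (norm z)\<^sup>2 / 2)) * exp (- (norm z)\<^sup>2)"
      by (intro mult_right_mono) auto
    also have "\<dots> = (C * fact k * exp (3/2)) * exp (3/2 + (norm z)\<^sup>2 / 2 + - (norm z)\<^sup>2 - 3/2)"
      unfolding exp_add exp_diff by simp
    finally show ?thesis by simp
  qed
  then show ?thesis by blast
qed

lemma gauss_integrable_real: "integrable lborel (\<lambda>x::real. exp (- x\<^sup>2 / 2))"
proof -
  have "integrable lborel (\<lambda>x. sqrt (2 * pi) * (std_normal_density x * x ^ 0))"
    using integrable_std_normal_moment[of 0] by (intro integrable_mult_right)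
  moreover have "(\<lambda>x. sqrt (2 * pi) * (std_normal_density x * x ^ 0)) = (\<lambda>x. exp (- x\<^sup>2 / 2))"
    by (simp add: std_normal_density_def fun_eq_iff)
  ultimately show ?thesis by (simp only:)
qed

lemma gauss_integrable_plane: "integrable lborel (\<lambda>z::real \<times> real. exp (- (norm z)\<^sup>2 / 2))"
proof -
  have eq: "exp (- (norm (q, p))\<^sup>2 / 2) = exp (- q\<^sup>2 / 2) * exp (- p\<^sup>2 / 2)" for q p :: real
    by (simp add: norm_Pair exp_add[symmetric] add_divide_distrib diff_divide_distrib)
  have "integrable (lborel \<Otimes>\<^sub>M lborel) (\<lambda>z::real \<times> real. exp (- (norm z)\<^sup>2 / 2))"
  proof (rule lborel_pair.Fubini_integrable)
    show "(\<lambda>z::real \<times> real. exp (- (norm z)\<^sup>2 / 2)) \<in> borel_measurable (lborel \<Otimes>\<^sub>M lborel)"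
      by (simp add: lborel_prod)
    show "integrable lborel (\<lambda>x. LINT y|lborel. norm (exp (- (norm (x::real, y::real))\<^sup>2 / 2)))"
      unfolding eq by (simp add: abs_mult gauss_integrable_real[simplified])
    show "AE x in lborel. integrable lborel (\<lambda>y. exp (- (norm (x::real, y::real))\<^sup>2 / 2))"
      unfolding eq by (simp add: gauss_integrable_real[simplified])
  qed
  then show ?thesis by (simp add: lborel_prod)
qed

text \<open>Integrability of the half Gaussian is a premise so that the same lemma serves the line
  and the plane.\<close>

lemma poly_growth_gauss_integrable:
  fixes f :: "'a::euclidean_space \<Rightarrow> 'b::{banach, second_countable_topology}"
  assumes "integrable lborel (\<lambda>z::'a. exp (- (norm z)\<^sup>2 / 2))"
    and f: "poly_growth f"
  shows "integrable lborel (\<lambda>z. exp (- (norm z)\<^sup>2) *\<^sub>R f z)"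
proof -
  obtain C where C: "\<And>z. norm (f z) * exp (- (norm z)\<^sup>2) \<le> C * exp (- (norm z)\<^sup>2 / 2)"
    using poly_growth_gauss_bound[OF f] by blast
  have "integrable lborel (\<lambda>z::'a. C * exp (- (norm z)\<^sup>2 / 2))"
    using assms(1) by (rule integrable_mult_right)
  then show ?thesis
  proof (rule Bochner_Integration.integrable_bound)
    have "f \<in> borel_measurable borel" using f by (rule poly_growth_measurable)
    then show "(\<lambda>z. exp (- (norm z)\<^sup>2) *\<^sub>R f z) \<in> borel_measurable lborel" by simp
    show "AE z in lborel. norm (exp (- (norm z)\<^sup>2) *\<^sub>R f z) \<le> norm (C * exp (- (norm z)\<^sup>2 / 2))"
    proof (intro AE_I2)
      fix z
      have "norm (exp (- (norm z)\<^sup>2) *\<^sub>R f z) \<le> C * exp (- (norm z)\<^sup>2 / 2)"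
        using C[of z] by (simp add: mult.commute)
      also have "\<dots> \<le> \<bar>C * exp (- (norm z)\<^sup>2 / 2)\<bar>" by (rule abs_ge_self)
      finally show "norm (exp (- (norm z)\<^sup>2) *\<^sub>R f z) \<le> norm (C * exp (- (norm z)\<^sup>2 / 2))" by simp
    qed
  qed
qed

section \<open>Gaussian integrals of polynomials with a linear phase\<close>

definition gauss_kernel :: "real \<Rightarrow> real \<Rightarrow> complex" where
  "gauss_kernel b y = exp (2 * \<i> * complex_of_real b * complex_of_real y - complex_of_real (y\<^sup>2))"

text \<open>Taking a formal polynomial as argument makes this a linear functional. The kernel is the
  Fourier phase of \<open>wigner\<close> times the Gaussian in \<open>y\<close> that splits off from
  a product of two vacuum functions.\<close>

definition gauss_poly_integral :: "real \<Rightarrow> complex poly \<Rightarrow> complex" where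
  "gauss_poly_integral b P = (LINT y|lborel. gauss_kernel b y * poly P (complex_of_real y))"

lemma norm_gauss_kernel: "norm (gauss_kernel b y) = exp (- y\<^sup>2)"
  unfolding gauss_kernel_def by (simp add: power2_eq_square)

lemma poly_growth_of_real: "poly_growth complex_of_real"
  by (intro poly_growth_norm_bound) auto

lemma gauss_poly_integrable:
  "integrable lborel (\<lambda>y. gauss_kernel b y * poly P (complex_of_real y))"
proof -
  have "poly_growth (\<lambda>y. poly P (complex_of_real y))"
    by (rule poly_growth_poly[OF poly_growth_of_real])
  from poly_growth_gauss_integrable[OF _ this] gauss_integrable_real
  have "integrable lborel (\<lambda>y. exp (- y\<^sup>2) *\<^sub>R poly P (complex_of_real y))"
    by simp
  then show ?thesis
  proof (rule Bochner_Integration.integrable_bound)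
    have "(\<lambda>y. gauss_kernel b y * poly P (complex_of_real y)) \<in> borel_measurable borel"
      unfolding gauss_kernel_def by (intro borel_measurable_continuous_onI continuous_intros)
    then show "(\<lambda>y. gauss_kernel b y * poly P (complex_of_real y)) \<in> borel_measurable lborel"
      by simp
  qed (simp add: norm_mult norm_gauss_kernel)
qed

lemma gauss_poly_tendsto:
  assumes "filterlim (\<lambda>y. y\<^sup>2) at_top F"
  shows "((\<lambda>y. gauss_kernel b y * poly P (complex_of_real y)) \<longlongrightarrow> 0) F"
proof -
  have "poly_growth (\<lambda>y. poly P (complex_of_real y))"
    by (rule poly_growth_poly[OF poly_growth_of_real])
  from poly_growth_gauss_bound[OF this]
  obtain C where C: "\<And>y. norm (poly P (complex_of_real y)) * exp (- y\<^sup>2) \<le> C * exp (- y\<^sup>2 / 2)"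
    by auto
  have "((\<lambda>x::real. C * exp (- x / 2)) \<longlongrightarrow> 0) at_top"
    by real_asymp
  from filterlim_compose[OF this assms]
  have "((\<lambda>y. C * exp (- y\<^sup>2 / 2)) \<longlongrightarrow> 0) F" .
  then show ?thesis
    by (rule Lim_null_comparison[rotated])
       (use C in \<open>auto simp: norm_mult norm_gauss_kernel mult.commute\<close>)
qed

lemma gauss_kernel_has_vector_derivative:
  "(gauss_kernel b has_vector_derivative
     (2 * \<i> * complex_of_real b - 2 * complex_of_real y) * gauss_kernel b y) (at y)"
proof -
  have "((\<lambda>z. exp (2 * \<i> * complex_of_real b * z - z\<^sup>2)) has_field_derivative
      (2 * \<i> * complex_of_real b - 2 * complex_of_real y)
        * exp (2 * \<i> * complex_of_real b * complex_of_real y - (complex_of_real y)\<^sup>2)) (at (complex_of_real y))"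
    by (auto intro!: derivative_eq_intros)
  from has_vector_derivative_real_field[OF this] show ?thesis
    by (simp add: gauss_kernel_def[abs_def] o_def)
qed

lemma gauss_poly_integral_add:
  "gauss_poly_integral b (P + Q) = gauss_poly_integral b P + gauss_poly_integral b Q"
  by (simp add: gauss_poly_integral_def distrib_left gauss_poly_integrable)

lemma gauss_poly_integral_smult:
  "gauss_poly_integral b (smult c P) = c * gauss_poly_integral b P"
proof -
  have "gauss_poly_integral b (smult c P) = (LINT y|lborel. c * (gauss_kernel b y * poly P (complex_of_real y)))"
    by (simp add: gauss_poly_integral_def mult_ac)
  then show ?thesis by (simp add: gauss_poly_integral_def)
qed

text \<open>The derivative of \<open>gauss_kernel b y\<close> times \<open>P\<close> is
  \<open>gauss_kernel b y\<close> times (2ib - 2y) P + P'. Its integral is 0 because the boundary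
  values vanish; solving for the term y P gives the claim. For \<open>b = 0\<close> this is Stein's
  identity.\<close>

lemma gauss_poly_integral_by_parts:
  "gauss_poly_integral b ([:0, 1:] * P)
     = \<i> * complex_of_real b * gauss_poly_integral b P + gauss_poly_integral b (pderiv P) / 2"
proof -
  define Q where "Q = [:2 * \<i> * complex_of_real b, -2:] * P + pderiv P"
  let ?F = "\<lambda>y. gauss_kernel b y * poly P (complex_of_real y)"
  have deriv: "(?F has_vector_derivative gauss_kernel b y * poly Q (complex_of_real y)) (at y)" for y
  proof -
    have "((\<lambda>y. poly P (complex_of_real y)) has_vector_derivative poly (pderiv P) (complex_of_real y)) (at y)"
      using has_vector_derivative_real_field[OF poly_DERIV[of P "complex_of_real y"]] by (simp add: o_def)
    from has_vector_derivative_mult[OF gauss_kernel_has_vector_derivative this]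
    show ?thesis by (rule has_vector_derivative_eq_rhs) (simp add: Q_def algebra_simps)
  qed
  have "(LBINT y=-\<infinity>..\<infinity>. gauss_kernel b y * poly Q (complex_of_real y)) = 0 - 0"
  proof (rule interval_integral_FTC_integrable[where F = ?F])
    show "isCont (\<lambda>y. gauss_kernel b y * poly Q (complex_of_real y)) y" for y
      unfolding gauss_kernel_def by (intro continuous_intros)
    show "set_integrable lborel (einterval (-\<infinity>) \<infinity>) (\<lambda>y. gauss_kernel b y * poly Q (complex_of_real y))"
      by (simp add: set_integrable_def gauss_poly_integrable)
    have "(?F \<longlongrightarrow> 0) at_bot" "(?F \<longlongrightarrow> 0) at_top"
      by (rule gauss_poly_tendsto; real_asymp)+
    then show "((?F \<circ> real_of_ereal) \<longlongrightarrow> 0) (at_right (-\<infinity>))" "((?F \<circ> real_of_ereal) \<longlongrightarrow> 0) (at_left \<infinity>)"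
      by (simp_all only: ereal_tendsto_simps1)
  qed (auto intro: deriv)
  then have "gauss_poly_integral b Q = 0"
    by (simp add: interval_lebesgue_integral_def set_lebesgue_integral_def gauss_poly_integral_def)
  moreover have "Q = smult (2 * \<i> * complex_of_real b) P + (smult (-2) ([:0, 1:] * P) + pderiv P)"
    by (simp add: Q_def)
  ultimately have "0 = 2 * \<i> * complex_of_real b * gauss_poly_integral b P
      + (- 2 * gauss_poly_integral b ([:0, 1:] * P) + gauss_poly_integral b (pderiv P))"
    by (simp only: gauss_poly_integral_add gauss_poly_integral_smult)
  then show ?thesis by (simp add: field_simps del: mult_pCons_left)
qed

lemma gauss_poly_integral_1: "gauss_poly_integral b 1 = complex_of_real (sqrt pi * exp (- b\<^sup>2))"
proof -
  \<comment> \<open>The Fourier transform of the Gaussian is borrowed from the characteristic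
    function of the standard normal law; the substitution x = sqrt 2 * y turns the weight into exp
    (- y^2) and the phase into 2 b y.\<close>
  have "complex_of_real (exp (- ((sqrt 2 * b)\<^sup>2) / 2)) = char std_normal_distribution (sqrt 2 * b)"
    by (simp add: char_std_normal_distribution)
  also have "\<dots> = (LINT x|lborel. std_normal_density x *\<^sub>R iexp (sqrt 2 * b * x))"
    unfolding char_def by (subst integral_density) auto
  also have "\<dots> = sqrt 2 *\<^sub>R (LINT y|lborel. std_normal_density (sqrt 2 * y) *\<^sub>R iexp (sqrt 2 * b * (sqrt 2 * y)))"
    by (subst lborel_integral_real_affine[where c = "sqrt 2" and t = 0]) auto
  also have "(\<lambda>y. std_normal_density (sqrt 2 * y) *\<^sub>R iexp (sqrt 2 * b * (sqrt 2 * y)))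
      = (\<lambda>y. (1 / sqrt (2 * pi)) *\<^sub>R gauss_kernel b y)"
  proof
    fix y
    have "sqrt 2 * b * (sqrt 2 * y) = 2 * b * y" by simp
    then have "iexp (sqrt 2 * b * (sqrt 2 * y)) = exp (2 * \<i> * complex_of_real b * complex_of_real y)"
      by (simp only: of_real_mult of_real_numeral mult_ac)
    moreover have "std_normal_density (sqrt 2 * y) = (1 / sqrt (2 * pi)) * exp (- y\<^sup>2)"
      by (simp add: std_normal_density_def power_mult_distrib)
    moreover have "gauss_kernel b y = exp (2 * \<i> * complex_of_real b * complex_of_real y) * complex_of_real (exp (- y\<^sup>2))"
      unfolding gauss_kernel_def by (simp add: exp_diff exp_minus exp_of_real field_simps flip: of_real_power)
    ultimately show "std_normal_density (sqrt 2 * y) *\<^sub>R iexp (sqrt 2 * b * (sqrt 2 * y))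
        = (1 / sqrt (2 * pi)) *\<^sub>R gauss_kernel b y"
      by (simp add: scaleR_conv_of_real)
  qed
  also have "sqrt 2 *\<^sub>R (LINT y|lborel. (1 / sqrt (2 * pi)) *\<^sub>R gauss_kernel b y)
      = (1 / sqrt pi) *\<^sub>R gauss_poly_integral b 1"
    by (simp add: gauss_poly_integral_def real_sqrt_mult)
  finally show ?thesis
    by (simp add: power_mult_distrib scaleR_conv_of_real field_simps)
qed

section \<open>Wigner functions of number states\<close>

text \<open>Hermite polynomials in the physicists' normalisation (leading coefficient \<open>2 ^ n\<close>).\<close>

fun hermite :: "nat \<Rightarrow> complex poly" where
  "hermite 0 = 1"
| "hermite (Suc n) = [:0, 2:] * hermite n - pderiv (hermite n)"

text \<open>Differentiating the recursion gives twice the old polynomial plus the recursion applied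
  to its derivative, which collapses by the induction hypothesis. For \<open>n = 0\<close> the
  factor 0 hides the truncated index.\<close>

lemma pderiv_hermite: "pderiv (hermite n) = smult (2 * of_nat n) (hermite (n - 1))"
proof (induction n)
  case (Suc n)
  show ?case
  proof (cases n)
    case (Suc k)
    have "pderiv (hermite (Suc n)) = smult 2 (hermite n) + [:0, 2:] * pderiv (hermite n) - pderiv (pderiv (hermite n))"
      by (simp add: pderiv_mult pderiv_diff pderiv_pCons pderiv_smult)
    also have "\<dots> = smult 2 (hermite n) + smult (2 * of_nat n) ([:0, 2:] * hermite k - pderiv (hermite k))"
    proof -
      have "pderiv (hermite n) = smult (2 * of_nat n) (hermite k)"
        using Suc.IH Suc by simp
      then show ?thesis by (simp add: pderiv_smult smult_diff_right algebra_simps)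
    qed
    also have "[:0, 2:] * hermite k - pderiv (hermite k) = hermite n"
      using Suc by simp
    finally show ?thesis by (simp add: smult_add_left[symmetric] algebra_simps del: hermite.simps)
  qed (simp add: pderiv_pCons)
qed simp

lemma coeff_hermite_Reals: "coeff (hermite n) i \<in> \<real>"
proof (induction n arbitrary: i)
  case 0
  show ?case by (cases i) (auto simp: coeff_1)
next
  case (Suc n)
  then show ?case by (cases i) (auto simp: coeff_pderiv intro!: Reals_diff Reals_mult)
qed

lemma cnj_poly_hermite: "cnj (poly (hermite n) (complex_of_real x)) = poly (hermite n) (complex_of_real x)"
proof -
  have "poly (hermite n) (complex_of_real x) \<in> \<real>"
    unfolding poly_altdef by (intro sum_in_Reals Reals_mult Reals_power coeff_hermite_Reals) auto
  then show ?thesis by (simp add: Reals_cnj_iff)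
qed

text \<open>Creation is (x - d/dx) / sqrt 2, and differentiating the vacuum contributes a second x;
  on the polynomial factor this is the Hermite recursion.\<close>

lemma creation_poly_vacuum:
  "creation (\<lambda>x. c * poly P (complex_of_real x) * vacuum x) =
    (\<lambda>x. c / complex_of_real (sqrt 2) * poly ([:0, 2:] * P - pderiv P) (complex_of_real x) * vacuum x)"
proof
  fix x
  have "((\<lambda>x. poly P (complex_of_real x)) has_vector_derivative poly (pderiv P) (complex_of_real x)) (at x)"
    using has_vector_derivative_real_field[OF poly_DERIV[of P "complex_of_real x"]] by (simp add: o_def)
  from has_vector_derivative_mult[OF has_vector_derivative_mult[OF has_vector_derivative_const this]
      vacuum_has_vector_derivative, of c]
  have "vector_derivative (\<lambda>x. c * poly P (complex_of_real x) * vacuum x) (at x)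
      = c * poly P (complex_of_real x) * (- complex_of_real x * vacuum x)
        + c * poly (pderiv P) (complex_of_real x) * vacuum x"
    by (simp add: vector_derivative_at)
  then show "creation (\<lambda>x. c * poly P (complex_of_real x) * vacuum x) x
      = c / complex_of_real (sqrt 2) * poly ([:0, 2:] * P - pderiv P) (complex_of_real x) * vacuum x"
    by (simp add: creation_def position_op_def momentum_op_def field_simps)
qed

lemma fock_hermite:
  "fock n x = poly (hermite n) (complex_of_real x) / complex_of_real (sqrt (2 ^ n * fact n)) * vacuum x"
proof -
  have "(creation ^^ n) vacuum
      = (\<lambda>x. 1 / complex_of_real (sqrt 2 ^ n) * poly (hermite n) (complex_of_real x) * vacuum x)"
  proof (induction n)
    case (Suc n)
    then show ?case
      by (simp only: funpow.simps o_apply creation_poly_vacuum hermite.simps) (simp add: mult.commute)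
  qed simp
  then show ?thesis
    by (simp add: fock_def real_sqrt_mult real_sqrt_power)
qed

section \<open>Closed form of the Wigner integral for a pair of Fock states\<close>

lemma gauss_poly_integral_diff:
  "gauss_poly_integral b (P - Q) = gauss_poly_integral b P - gauss_poly_integral b Q"
  using gauss_poly_integral_add[of b P "- Q"] gauss_poly_integral_smult[of b "- 1" Q] by simp

text \<open>Up to Gaussian prefactors this is the Wigner function of \<open>|m\<rangle>\<langle>n|\<close>.\<close>

definition hermite_pair :: "real \<Rightarrow> real \<Rightarrow> nat \<Rightarrow> nat \<Rightarrow> complex" where
  "hermite_pair q p m n = gauss_poly_integral p
     (pcompose (hermite m) [:complex_of_real q, -1:] * pcompose (hermite n) [:complex_of_real q, 1:])"

lemma gauss_poly_integral_linear_mult: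
  "gauss_poly_integral b ([:c, d:] * P) =
     (c + d * \<i> * complex_of_real b) * gauss_poly_integral b P + d / 2 * gauss_poly_integral b (pderiv P)"
proof -
  have "[:c, d:] * P = smult c P + smult d ([:0, 1:] * P)"
    by simp
  then show ?thesis
    by (simp only: gauss_poly_integral_add gauss_poly_integral_smult gauss_poly_integral_by_parts)
       (simp add: algebra_simps)
qed

text \<open>The Hermite recursion brings in 2 (q + y) and subtracts a derivative. Integration by
  parts replaces 2y by 2ip plus the derivative of the whole product. Its part on the right factor
  cancels the subtracted derivative; its part on the left factor lowers \<open>m\<close>, with a
  minus sign from the inner function q - y.\<close>

lemma hermite_pair_Suc_right:
  "hermite_pair q p m (Suc n) =
     2 * Complex q p * hermite_pair q p m n - 2 * of_nat m * hermite_pair q p (m - 1) n"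
proof -
  let ?F = "pcompose (hermite m) [:complex_of_real q, -1:]" and ?G = "pcompose (hermite n) [:complex_of_real q, 1:]"
  let ?F' = "pcompose (hermite (m - 1)) [:complex_of_real q, -1:]"
  let ?G' = "pcompose (pderiv (hermite n)) [:complex_of_real q, 1:]"
  have F': "pderiv ?F = smult (- 2 * of_nat m) ?F'"
    by (simp add: pderiv_pcompose pderiv_hermite pderiv_pCons pcompose_smult)
  have G': "pderiv ?G = ?G'"
    by (simp add: pderiv_pcompose pderiv_pCons)
  have "?F * pcompose (hermite (Suc n)) [:complex_of_real q, 1:]
      = [:2 * complex_of_real q, 2:] * (?F * ?G) - ?F * ?G'"
    by (simp add: pcompose_diff pcompose_smult pcompose_pCons smult_add_right algebra_simps)
  then have "hermite_pair q p m (Suc n)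
      = (2 * complex_of_real q + 2 * \<i> * complex_of_real p) * gauss_poly_integral p (?F * ?G)
        + gauss_poly_integral p (pderiv (?F * ?G)) - gauss_poly_integral p (?F * ?G')"
    by (simp only: hermite_pair_def gauss_poly_integral_diff gauss_poly_integral_linear_mult) simp
  also have "pderiv (?F * ?G) = ?F * ?G' + smult (- 2 * of_nat m) (?F' * ?G)"
    by (simp add: pderiv_mult F' G' mult.commute)
  finally show ?thesis
    by (simp add: hermite_pair_def gauss_poly_integral_add gauss_poly_integral_diff gauss_poly_integral_smult
        Complex_eq algebra_simps del: hermite.simps)
qed

text \<open>Here the sign of q - y makes the derivative from integration by parts cancel the Hermite
  derivative completely, so each step only multiplies by 2 (q - ip).\<close>

lemma hermite_pair_0_right:
  "hermite_pair q p m 0 = (2 * cnj (Complex q p)) ^ m * complex_of_real (sqrt pi * exp (- p\<^sup>2))"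
proof (induction m)
  case 0
  show ?case by (simp add: hermite_pair_def gauss_poly_integral_1 pcompose_1)
next
  case (Suc m)
  let ?F = "pcompose (hermite m) [:complex_of_real q, -1:]"
  let ?F' = "pcompose (pderiv (hermite m)) [:complex_of_real q, -1:]"
  have "pcompose (hermite (Suc m)) [:complex_of_real q, -1:] = [:2 * complex_of_real q, -2:] * ?F - ?F'"
    by (simp add: pcompose_diff pcompose_smult pcompose_pCons smult_add_right algebra_simps)
  moreover have "pderiv ?F = smult (-1) ?F'"
    by (simp add: pderiv_pcompose pderiv_pCons)
  ultimately have "hermite_pair q p (Suc m) 0 = 2 * cnj (Complex q p) * hermite_pair q p m 0"
    by (simp only: hermite_pair_def gauss_poly_integral_diff gauss_poly_integral_linear_mult
        hermite.simps(1) pcompose_1 mult_1_right gauss_poly_integral_smult)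
       (simp add: complex_eq_iff algebra_simps)
  with Suc.IH show ?case by simp
qed

text \<open>Pascal's rule solves the recursion: the two summands of
  \<open>Suc n choose Suc j\<close> correspond to its two terms. The truncated exponent
  \<open>m - j\<close> is harmless because \<open>m choose j\<close> vanishes for j > m.\<close>

lemma hermite_pair_eq:
  "hermite_pair q p m n =
     (\<Sum>j\<le>n. (-2) ^ j * of_nat (fact j * (m choose j) * (n choose j))
        * (2 * cnj (Complex q p)) ^ (m - j) * (2 * Complex q p) ^ (n - j))
     * complex_of_real (sqrt pi * exp (- p\<^sup>2))"
proof (induction n arbitrary: m)
  case 0
  show ?case by (simp add: hermite_pair_0_right)
next
  case (Suc n)
  let ?z = "2 * Complex q p" and ?w = "2 * cnj (Complex q p)"
  define S where "S = (\<lambda>m n. \<Sum>j\<le>n. (-2) ^ j * of_nat (fact j * (m choose j) * (n choose j)) * ?w ^ (m - j) * ?z ^ (n - j))"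
  have zS: "?z * S m n = ?w ^ m * ?z ^ Suc n
      + (\<Sum>j\<le>n. (-2) ^ Suc j * of_nat (fact (Suc j) * (m choose Suc j) * (n choose Suc j)) * ?w ^ (m - Suc j) * ?z ^ (n - j))"
  proof -
    have "?z * S m n = (\<Sum>j\<le>n. (-2) ^ j * of_nat (fact j * (m choose j) * (n choose j)) * ?w ^ (m - j) * ?z ^ (Suc n - j))"
      unfolding S_def sum_distrib_left by (intro sum.cong) (auto simp: Suc_diff_le)
    \<comment> \<open>The added summand \<open>j = Suc n\<close> is 0 because
      \<open>n choose Suc n\<close> is; with it the range allows splitting off
      \<open>j = 0\<close>.\<close>
    also have "\<dots> = (\<Sum>j\<le>Suc n. (-2) ^ j * of_nat (fact j * (m choose j) * (n choose j)) * ?w ^ (m - j) * ?z ^ (Suc n - j))"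
      by simp
    finally show ?thesis unfolding sum.atMost_Suc_shift by simp
  qed
  have mS: "2 * of_nat m * S (m - 1) n
      = - (\<Sum>j\<le>n. (-2) ^ Suc j * of_nat (fact (Suc j) * (m choose Suc j) * (n choose j)) * ?w ^ (m - Suc j) * ?z ^ (n - j))"
  proof -
    \<comment> \<open>Absorption converts the factor \<open>m\<close> of the recursion into a shift
      of the summation index.\<close>
    have "fact (Suc j) * (m choose Suc j) = m * (fact j * (m - 1 choose j))" for j
    proof -
      have "fact (Suc j) * (m choose Suc j) = fact j * (Suc j * (m choose Suc j))"
        by (simp only: fact_Suc of_nat_id mult_ac)
      then show ?thesis by (simp only: binomial_absorption mult_ac)
    qed
    then show ?thesis
      unfolding S_def sum_distrib_left sum_negf[symmetric]
      by (intro sum.cong) (simp_all add: mult_ac)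
  qed
  have "S m (Suc n) = ?w ^ m * ?z ^ Suc n
      + (\<Sum>j\<le>n. (-2) ^ Suc j * of_nat (fact (Suc j) * (m choose Suc j) * (n choose Suc j)) * ?w ^ (m - Suc j) * ?z ^ (n - j))
      + (\<Sum>j\<le>n. (-2) ^ Suc j * of_nat (fact (Suc j) * (m choose Suc j) * (n choose j)) * ?w ^ (m - Suc j) * ?z ^ (n - j))"
    unfolding S_def sum.atMost_Suc_shift add.assoc sum.distrib[symmetric]
    by (simp add: algebra_simps)
  also have "\<dots> = ?z * S m n - 2 * of_nat m * S (m - 1) n"
    unfolding zS mS by simp
  finally show ?case
    using Suc.IH unfolding hermite_pair_Suc_right S_def by (simp add: left_diff_distrib mult.assoc)
qed

text \<open>Quotient of the Wigner function of |0><n| + |n><0| by that of the vacuum.\<close>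

definition coherence_ratio :: "nat \<Rightarrow> real \<times> real \<Rightarrow> real" where
  "coherence_ratio n z = 2 * sqrt (2 ^ n / fact n) * Re (Complex (fst z) (snd z) ^ n)"

text \<open>This is \<open>(-1) ^ n * L (2 * (norm z)\<^sup>2)\<close> for the Laguerre polynomial \<open>L\<close> of degree \<open>n\<close>.\<close>

definition population_ratio :: "nat \<Rightarrow> real \<times> real \<Rightarrow> real" where
  "population_ratio n z = (\<Sum>k\<le>n. (-1) ^ (n - k) * 2 ^ k * real (n choose k) / fact k * norm z ^ (2 * k))"

lemma hermite_pair_0_left:
  "hermite_pair q p 0 n = (2 * Complex q p) ^ n * complex_of_real (sqrt pi * exp (- p\<^sup>2))"
proof -
  have "(\<Sum>j\<le>n. (-2) ^ j * of_nat (fact j * (0 choose j) * (n choose j))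
        * (2 * cnj (Complex q p)) ^ (0 - j) * (2 * Complex q p) ^ (n - j))
    = (\<Sum>j\<le>n. if j = 0 then (2 * Complex q p) ^ n else 0)"
    by (intro sum.cong) auto
  then show ?thesis by (simp add: hermite_pair_eq)
qed

lemma hermite_pair_diag:
  "hermite_pair q p n n = complex_of_real (2 ^ n * fact n * population_ratio n (q, p) * sqrt pi * exp (- p\<^sup>2))"
proof -
  let ?z = "Complex q p"
  \<comment> \<open>Reversing the sum by k = n - j sorts it by powers of the norm; the prefactor n!
    arises from \<open>fact j * (n choose k) = fact n / fact k\<close>.\<close>
  have "(\<Sum>j\<le>n. (-2) ^ j * of_nat (fact j * (n choose j) * (n choose j)) * (2 * cnj ?z) ^ (n - j) * (2 * ?z) ^ (n - j))
      = (\<Sum>k\<le>n. complex_of_real (2 ^ n * fact n * ((-1) ^ (n - k) * 2 ^ k * real (n choose k) / fact k * norm (q, p) ^ (2 * k))))"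
  proof (rule sum.reindex_bij_witness[of _ "\<lambda>k. n - k" "\<lambda>k. n - k"])
    fix j assume "j \<in> {..n}"
    then have j: "j \<le> n" by simp
    define k where "k = n - j"
    have k: "k \<le> n" "j = n - k" "n = j + k" using j by (auto simp: k_def)
    have zz: "(2 * cnj ?z) ^ k * (2 * ?z) ^ k = complex_of_real (4 ^ k * norm (q, p) ^ (2 * k))"
    proof -
      have "(2 * cnj ?z) * (2 * ?z) = complex_of_real (4 * norm (q, p) ^ 2)"
        by (simp add: complex_eq_iff norm_Pair power2_eq_square)
      then have "(2 * cnj ?z) ^ k * (2 * ?z) ^ k = complex_of_real ((4 * norm (q, p) ^ 2) ^ k)"
        by (simp only: power_mult_distrib[symmetric] of_real_power)
      then show ?thesis by (simp only: power_mult_distrib power_mult)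
    qed
    have "fact k * fact j * real (n choose k) = fact n"
      using binomial_fact_lemma[OF k(1)] k(2) by (metis of_nat_fact of_nat_mult)
    then have bin: "fact j * real (n choose k) = fact n / fact k"
      by (simp add: field_simps)
    have two: "(2::real) ^ j * 4 ^ k = 2 ^ n * 2 ^ k"
    proof -
      have "(4::real) ^ k = (2 * 2) ^ k" by simp
      then show ?thesis using k(3) by (simp only: power_mult_distrib power_add mult_ac)
    qed
    have sym: "n choose j = n choose k" using binomial_symmetric[OF k(1)] k(2) by simp
    have "(-2) ^ j * of_nat (fact j * (n choose j) * (n choose j)) * (2 * cnj ?z) ^ k * (2 * ?z) ^ k
        = complex_of_real ((-2) ^ j * real (fact j * (n choose k) * (n choose k)) * (4 ^ k * norm (q, p) ^ (2 * k)))"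
      unfolding sym mult.assoc[of _ "(2 * cnj ?z) ^ k"] zz by simp
    also have "(-2) ^ j * real (fact j * (n choose k) * (n choose k)) * (4 ^ k * norm (q, p) ^ (2 * k))
        = (-1) ^ j * (2 ^ j * 4 ^ k) * ((fact j * real (n choose k)) * real (n choose k)) * norm (q, p) ^ (2 * k)"
      by (simp add: power_minus[of "2::real"] mult_ac)
    also have "\<dots> = 2 ^ n * fact n * ((-1) ^ (n - k) * 2 ^ k * real (n choose k) / fact k * norm (q, p) ^ (2 * k))"
      unfolding bin two using k(2) by simp
    finally show "complex_of_real (2 ^ n * fact n * ((-1) ^ (n - (n - j)) * 2 ^ (n - j) * real (n choose (n - j))
          / fact (n - j) * norm (q, p) ^ (2 * (n - j))))
        = (-2) ^ j * of_nat (fact j * (n choose j) * (n choose j)) * (2 * cnj ?z) ^ (n - j) * (2 * ?z) ^ (n - j)"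
      unfolding k_def by simp
  qed auto
  then show ?thesis
    unfolding hermite_pair_eq population_ratio_def
    by (simp only: of_real_sum[symmetric] of_real_mult[symmetric] sum_distrib_left[symmetric] mult.assoc)
qed

lemma fock_pair_gauss:
  "exp (2 * \<i> * complex_of_real p * complex_of_real y) * (fock m (q - y) * cnj (fock n (q + y)))
    = complex_of_real (exp (- q\<^sup>2) / (sqrt pi * sqrt (2 ^ m * fact m) * sqrt (2 ^ n * fact n)))
      * (gauss_kernel p y * poly (pcompose (hermite m) [:complex_of_real q, -1:]
          * pcompose (hermite n) [:complex_of_real q, 1:]) (complex_of_real y))"
proof -
  have vac: "vacuum (q - y) * cnj (vacuum (q + y)) = complex_of_real (exp (- q\<^sup>2) / sqrt pi * exp (- y\<^sup>2))"
  proof -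
    have "pi powr (- (1/4)) * pi powr (- (1/4)) = 1 / sqrt pi"
      by (simp add: powr_add[symmetric] powr_minus powr_half_sqrt field_simps)
    moreover have "exp (- (q - y)\<^sup>2 / 2) * exp (- (q + y)\<^sup>2 / 2) = exp (- q\<^sup>2) * exp (- y\<^sup>2)"
    proof -
      \<comment> \<open>Parallelogram identity: the cross terms in q y cancel, so the two vacuum
        factors become one Gaussian in \<open>q\<close> and one in \<open>y\<close>.\<close>
      have "- (q - y)\<^sup>2 / 2 + - (q + y)\<^sup>2 / 2 = - q\<^sup>2 + - y\<^sup>2"
        by (simp add: power2_eq_square field_simps)
      then show ?thesis by (simp only: exp_add[symmetric])
    qed
    moreover have "(pi powr (- (1/4)) * exp (- (q - y)\<^sup>2 / 2)) * (pi powr (- (1/4)) * exp (- (q + y)\<^sup>2 / 2))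
        = (pi powr (- (1/4)) * pi powr (- (1/4))) * (exp (- (q - y)\<^sup>2 / 2) * exp (- (q + y)\<^sup>2 / 2))"
      by (simp only: mult_ac)
    ultimately have "(pi powr (- (1/4)) * exp (- (q - y)\<^sup>2 / 2)) * (pi powr (- (1/4)) * exp (- (q + y)\<^sup>2 / 2))
        = 1 / sqrt pi * (exp (- q\<^sup>2) * exp (- y\<^sup>2))"
      by (simp only:)
    then show ?thesis
      unfolding vacuum_def complex_cnj_complex_of_real of_real_mult[symmetric] by simp
  qed
  have kern: "gauss_kernel p y = exp (2 * \<i> * complex_of_real p * complex_of_real y) * complex_of_real (exp (- y\<^sup>2))"
    unfolding gauss_kernel_def by (simp add: exp_diff exp_minus exp_of_real field_simps flip: of_real_power)
  have "fock m (q - y) * cnj (fock n (q + y))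
      = poly (hermite m) (complex_of_real (q - y)) * poly (hermite n) (complex_of_real (q + y))
        / complex_of_real (sqrt (2 ^ m * fact m) * sqrt (2 ^ n * fact n)) * (vacuum (q - y) * cnj (vacuum (q + y)))"
    unfolding fock_hermite complex_cnj_mult complex_cnj_divide cnj_poly_hermite by simp
  then show ?thesis
    unfolding vac kern by (simp add: poly_pcompose mult_ac)
qed

text \<open>All four matrix elements are gathered into one polynomial \<open>R\<close> before
  integrating, so the Wigner integral is a single value of a linear functional and only pairs with a
  closed form remain.\<close>

lemma wigner_sigma_state:
  "wigner (sigma_state n t l) q p = exp (- (norm (q, p))\<^sup>2) / pi
     * (1 + l * t * coherence_ratio n (q, p) + t\<^sup>2 * population_ratio n (q, p)) / (1 + t\<^sup>2)"
proof -
  define N where "N = (2 ^ n * fact n :: real)"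
  have N: "N > 0" by (simp add: N_def)
  define P where "P = (\<lambda>m n. pcompose (hermite m) [:complex_of_real q, -1:] * pcompose (hermite n) [:complex_of_real q, 1:])"
  define s where "s = complex_of_real (exp (- q\<^sup>2) / (sqrt pi * (1 + t\<^sup>2)))"
  define R where "R = smult s (P 0 0 + smult (complex_of_real (t\<^sup>2 / N)) (P n n)
      + smult (complex_of_real (l * t / sqrt N)) (P 0 n + P n 0))"
  have "exp (2 * \<i> * complex_of_real p * complex_of_real y) * sigma_state n t l (q - y) (q + y)
      = gauss_kernel p y * poly R (complex_of_real y)" for y
  proof -
    let ?e = "exp (2 * \<i> * complex_of_real p * complex_of_real y)"
    have "?e * sigma_state n t l (q - y) (q + y) =
        (?e * (fock 0 (q - y) * cnj (fock 0 (q + y)))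
         + complex_of_real (t\<^sup>2) * (?e * (fock n (q - y) * cnj (fock n (q + y))))
         + complex_of_real (l * t) * (?e * (fock 0 (q - y) * cnj (fock n (q + y)))
             + ?e * (fock n (q - y) * cnj (fock 0 (q + y)))))
        / complex_of_real (1 + t\<^sup>2)"
      unfolding sigma_state_def ketbra_def by (simp add: algebra_simps)
    also have "\<dots> = gauss_kernel p y * poly R (complex_of_real y)"
    proof -
      define s' where "s' = complex_of_real (exp (- q\<^sup>2) / sqrt pi)"
      define d where "d = complex_of_real (1 + t\<^sup>2)"
      define N' where "N' = complex_of_real N"
      define r where "r = complex_of_real (sqrt N)"
      have "pcompose (hermite m) [:complex_of_real q, -1:] * pcompose (hermite k) [:complex_of_real q, 1:] = P m k" for m k
        by (simp add: P_def)
      moreover have "complex_of_real (exp (- q\<^sup>2) / (sqrt pi * sqrt N * sqrt N)) = s' / N'"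
        unfolding s'_def N'_def using N by (simp flip: of_real_mult)
      moreover have "s = s' / d" unfolding s_def s'_def d_def by simp
      moreover have "complex_of_real (t\<^sup>2 / N) = complex_of_real (t\<^sup>2) / N'" "complex_of_real (l * t / sqrt N) = complex_of_real (l * t) / r"
        unfolding N'_def r_def by simp_all
      moreover have "complex_of_real (exp (- q\<^sup>2) / (sqrt pi * sqrt (2 ^ 0 * fact 0) * sqrt N)) = s' / r"
        "complex_of_real (exp (- q\<^sup>2) / (sqrt pi * sqrt N * sqrt (2 ^ 0 * fact 0))) = s' / r"
        "complex_of_real (exp (- q\<^sup>2) / (sqrt pi * sqrt (2 ^ 0 * fact 0) * sqrt (2 ^ 0 * fact 0))) = s'"
        unfolding s'_def r_def by simp_all
      ultimately show ?thesis
        unfolding fock_pair_gauss N_def[symmetric] R_def d_def[symmetric]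
        by (simp only: poly_smult poly_add) (simp add: algebra_simps add_divide_distrib)
    qed
    finally show ?thesis .
  qed
  then have W: "wigner (sigma_state n t l) q p = Re (1 / complex_of_real pi * gauss_poly_integral p R)"
    by (simp add: wigner_def gauss_poly_integral_def)
  have H: "gauss_poly_integral p (P m k) = hermite_pair q p m k" for m k
    by (simp add: P_def hermite_pair_def)
  have re: "Re ((2 * cnj (Complex q p)) ^ n) = Re ((2 * Complex q p) ^ n)"
    by (metis complex_cnj_mult complex_cnj_numeral complex_cnj_power cnj.simps(1))
  have pw: "Re ((2 * Complex q p) ^ n) = 2 ^ n * Re (Complex q p ^ n)"
  proof -
    have "(2 * Complex q p) ^ n = complex_of_real (2 ^ n) * Complex q p ^ n"
      by (simp add: power_mult_distrib)
    then show ?thesis by simp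
  qed
  \<comment> \<open>The off-diagonal elements carry \<open>2 ^ n\<close> from the doubled argument
    and \<open>1 / sqrt N\<close> from the Fock normalisation; this gives the constant in
    \<open>coherence_ratio\<close>.\<close>
  have "2 * 2 ^ n / sqrt N = 2 * sqrt (2 ^ n / fact n)"
    unfolding N_def by (simp add: real_sqrt_mult real_sqrt_divide field_simps)
  then have coh: "(Re ((2 * Complex q p) ^ n) + Re ((2 * cnj (Complex q p)) ^ n)) / sqrt N = coherence_ratio n (q, p)"
  proof -
    have "(Re ((2 * Complex q p) ^ n) + Re ((2 * cnj (Complex q p)) ^ n)) / sqrt N = 2 * 2 ^ n / sqrt N * Re (Complex q p ^ n)"
      unfolding re pw by simp
    with \<open>2 * 2 ^ n / sqrt N = 2 * sqrt (2 ^ n / fact n)\<close> show ?thesis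
      by (simp add: coherence_ratio_def)
  qed
  have "gauss_poly_integral p R = s * complex_of_real (sqrt pi * exp (- p\<^sup>2))
     * (1 + complex_of_real (t\<^sup>2 * population_ratio n (q, p))
        + complex_of_real (l * t / sqrt N) * ((2 * Complex q p) ^ n + (2 * cnj (Complex q p)) ^ n))"
  proof -
    have "hermite_pair q p 0 0 = complex_of_real (sqrt pi * exp (- p\<^sup>2))"
      by (simp add: hermite_pair_0_right)
    moreover have "complex_of_real (t\<^sup>2 / N) * hermite_pair q p n n
        = complex_of_real (t\<^sup>2 * population_ratio n (q, p)) * complex_of_real (sqrt pi * exp (- p\<^sup>2))"
      unfolding hermite_pair_diag N_def[symmetric] of_real_mult[symmetric] using N by simp
    ultimately show ?thesis
      unfolding R_def gauss_poly_integral_add gauss_poly_integral_smult H hermite_pair_0_left[of q p n]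
        hermite_pair_0_right[of q p n] distrib_left
      by (simp add: algebra_simps)
  qed
  then have "wigner (sigma_state n t l) q p = exp (- q\<^sup>2) / (sqrt pi * (1 + t\<^sup>2)) * (sqrt pi * exp (- p\<^sup>2)) / pi
     * (1 + t\<^sup>2 * population_ratio n (q, p)
        + l * t / sqrt N * (Re ((2 * Complex q p) ^ n) + Re ((2 * cnj (Complex q p)) ^ n)))"
    unfolding W s_def by simp
  also have "\<dots> = (exp (- q\<^sup>2) * exp (- p\<^sup>2)) / pi
     * (1 + l * t * ((Re ((2 * Complex q p) ^ n) + Re ((2 * cnj (Complex q p)) ^ n)) / sqrt N)
          + t\<^sup>2 * population_ratio n (q, p)) / (1 + t\<^sup>2)"
    by (simp add: ac_simps)
  also have "exp (- q\<^sup>2) * exp (- p\<^sup>2) = exp (- (norm (q, p))\<^sup>2)"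
    by (simp add: norm_Pair exp_add[symmetric])
  finally show ?thesis unfolding coh .
qed

section \<open>Moments of the plane Gaussian\<close>

text \<open>The vacuum Wigner function as a reference measure. It has total mass 1, as
  \<open>plane_moment_0_0\<close> shows.\<close>

definition gauss_plane :: "(real \<times> real) measure" where
  "gauss_plane = density lborel (\<lambda>z. ennreal (exp (- (norm z)\<^sup>2) / pi))"

lemma sets_gauss_plane [measurable_cong, simp]: "sets gauss_plane = sets borel"
  by (simp add: gauss_plane_def)

lemma space_gauss_plane [simp]: "space gauss_plane = UNIV"
  by (simp add: gauss_plane_def)

lemma integrable_gauss_plane_iff:
  fixes f :: "real \<times> real \<Rightarrow> 'b::{banach, second_countable_topology}"
  assumes [measurable]: "f \<in> borel_measurable borel"
  shows "integrable gauss_plane f \<longleftrightarrow> integrable lborel (\<lambda>z. (exp (- (norm z)\<^sup>2) / pi) *\<^sub>R f z)"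
  unfolding gauss_plane_def by (rule integrable_density) auto

lemma integral_gauss_plane:
  fixes f :: "real \<times> real \<Rightarrow> 'b::{banach, second_countable_topology}"
  assumes [measurable]: "f \<in> borel_measurable borel"
  shows "integral\<^sup>L gauss_plane f = (LINT z|lborel. (exp (- (norm z)\<^sup>2) / pi) *\<^sub>R f z)"
  unfolding gauss_plane_def by (rule integral_density) auto

lemma poly_growth_integrable:
  fixes f :: "real \<times> real \<Rightarrow> 'b::{banach, second_countable_topology}"
  assumes "poly_growth f"
  shows "integrable gauss_plane f"
proof -
  have "integrable lborel (\<lambda>z. (1 / pi) *\<^sub>R (exp (- (norm z)\<^sup>2) *\<^sub>R f z))"
    by (intro integrable_scaleR_right poly_growth_gauss_integrable gauss_integrable_plane assms)
  then show ?thesis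
    using assms by (subst integrable_gauss_plane_iff) (auto simp: poly_growth_measurable)
qed

lemma LINT_gauss_poly:
  "(LINT y|lborel. exp (- y\<^sup>2) *\<^sub>R poly P (complex_of_real y)) = gauss_poly_integral 0 P"
proof -
  have "gauss_kernel 0 y = complex_of_real (exp (- y\<^sup>2))" for y
    by (simp add: gauss_kernel_def exp_of_real[symmetric])
  then show ?thesis
    by (simp add: gauss_poly_integral_def scaleR_conv_of_real)
qed

lemma gauss_stein:
  "(LINT y|lborel. exp (- y\<^sup>2) *\<^sub>R (complex_of_real y * poly P (complex_of_real y)))
    = (LINT y|lborel. exp (- y\<^sup>2) *\<^sub>R poly (pderiv P) (complex_of_real y)) / 2"
  using gauss_poly_integral_by_parts[of 0 P] LINT_gauss_poly[of "[:0, 1:] * P"] LINT_gauss_poly[of "pderiv P"]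
  by simp

lemma exp_norm_Pair: "exp (- (norm (q, p))\<^sup>2) = exp (- q\<^sup>2) * exp (- p\<^sup>2)" for q p :: real
  by (simp add: norm_Pair exp_add[symmetric])

lemma integrable_gauss_Pair:
  fixes f :: "real \<times> real \<Rightarrow> 'b::{banach, second_countable_topology}"
  assumes "poly_growth f"
  shows "integrable (lborel \<Otimes>\<^sub>M lborel) (\<lambda>z. (exp (- (norm z)\<^sup>2) / pi) *\<^sub>R f z)"
  using poly_growth_integrable[OF assms] assms
  by (simp add: lborel_prod integrable_gauss_plane_iff poly_growth_measurable)

text \<open>Both orders of Fubini are needed: Stein's identity is applied in \<open>q\<close> with
  \<open>p\<close> frozen, and in \<open>p\<close> with \<open>q\<close> frozen.\<close>

lemma integral_gauss_fst_inner:
  fixes f :: "real \<times> real \<Rightarrow> 'b::{banach, second_countable_topology}"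
  assumes f: "poly_growth f"
  shows "integral\<^sup>L gauss_plane f =
    (LINT p|lborel. (exp (- p\<^sup>2) / pi) *\<^sub>R (LINT q|lborel. exp (- q\<^sup>2) *\<^sub>R f (q, p)))"
proof -
  have "integral\<^sup>L gauss_plane f = (LINT z|(lborel \<Otimes>\<^sub>M lborel). (exp (- (norm z)\<^sup>2) / pi) *\<^sub>R f z)"
    by (simp add: integral_gauss_plane f poly_growth_measurable lborel_prod)
  also have "\<dots> = (LINT p|lborel. LINT q|lborel. (exp (- (norm (q, p))\<^sup>2) / pi) *\<^sub>R f (q, p))"
    using lborel_pair.integral_snd[of "\<lambda>q p. (exp (- (norm (q, p))\<^sup>2) / pi) *\<^sub>R f (q, p)"]
      integrable_gauss_Pair[OF f] by (simp add: case_prod_unfold)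
  also have "\<dots> = (LINT p|lborel. LINT q|lborel. (exp (- p\<^sup>2) / pi) *\<^sub>R (exp (- q\<^sup>2) *\<^sub>R f (q, p)))"
    unfolding exp_norm_Pair by (simp add: mult.commute)
  also have "\<dots> = (LINT p|lborel. (exp (- p\<^sup>2) / pi) *\<^sub>R (LINT q|lborel. exp (- q\<^sup>2) *\<^sub>R f (q, p)))"
    by (simp only: integral_scaleR_right)
  finally show ?thesis .
qed

lemma integral_gauss_snd_inner:
  fixes f :: "real \<times> real \<Rightarrow> 'b::{banach, second_countable_topology}"
  assumes f: "poly_growth f"
  shows "integral\<^sup>L gauss_plane f =
    (LINT q|lborel. (exp (- q\<^sup>2) / pi) *\<^sub>R (LINT p|lborel. exp (- p\<^sup>2) *\<^sub>R f (q, p)))"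
proof -
  have "integral\<^sup>L gauss_plane f = (LINT z|(lborel \<Otimes>\<^sub>M lborel). (exp (- (norm z)\<^sup>2) / pi) *\<^sub>R f z)"
    by (simp add: integral_gauss_plane f poly_growth_measurable lborel_prod)
  also have "\<dots> = (LINT q|lborel. LINT p|lborel. (exp (- (norm (q, p))\<^sup>2) / pi) *\<^sub>R f (q, p))"
    using lborel_pair.integral_fst'[OF integrable_gauss_Pair[OF f]] by simp
  also have "\<dots> = (LINT q|lborel. LINT p|lborel. (exp (- q\<^sup>2) / pi) *\<^sub>R (exp (- p\<^sup>2) *\<^sub>R f (q, p)))"
    unfolding exp_norm_Pair by simp
  also have "\<dots> = (LINT q|lborel. (exp (- q\<^sup>2) / pi) *\<^sub>R (LINT p|lborel. exp (- p\<^sup>2) *\<^sub>R f (q, p)))"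
    by (simp only: integral_scaleR_right)
  finally show ?thesis .
qed

lemma LINT_scaleR_half:
  fixes f :: "'a \<Rightarrow> complex"
  shows "(LINT x|M. r x *\<^sub>R (f x / 2)) = (LINT x|M. r x *\<^sub>R f x) / 2"
proof -
  have "(\<lambda>x. r x *\<^sub>R (f x / 2)) = (\<lambda>x. r x *\<^sub>R f x / 2)" by (simp add: scaleR_conv_of_real)
  then show ?thesis by simp
qed

section \<open>Complex moments of the plane Gaussian\<close>

definition plane_complex :: "real \<times> real \<Rightarrow> complex" where
  "plane_complex z = Complex (fst z) (snd z)"

lemma norm_plane_complex: "norm (plane_complex z) = norm z"
  by (simp add: plane_complex_def complex_norm norm_prod_def)

lemma poly_growth_fst: "poly_growth (\<lambda>z::real \<times> real. complex_of_real (fst z))"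
proof (rule poly_growth_norm_bound)
  show "(\<lambda>z::real \<times> real. complex_of_real (fst z)) \<in> borel_measurable borel"
    by (intro borel_measurable_continuous_onI continuous_intros)
qed (metis norm_fst_le norm_of_real prod.collapse real_norm_def)

lemma poly_growth_snd: "poly_growth (\<lambda>z::real \<times> real. complex_of_real (snd z))"
proof (rule poly_growth_norm_bound)
  show "(\<lambda>z::real \<times> real. complex_of_real (snd z)) \<in> borel_measurable borel"
    by (intro borel_measurable_continuous_onI continuous_intros)
qed (metis norm_snd_le norm_of_real prod.collapse real_norm_def)

lemma poly_growth_plane_complex [simp]: "poly_growth plane_complex"
proof (rule poly_growth_norm_bound)
  show "plane_complex \<in> borel_measurable borel"
    unfolding plane_complex_def Complex_eq
    by (intro borel_measurable_continuous_onI continuous_intros)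
qed (simp add: norm_plane_complex)

lemma poly_growth_cnj:
  assumes "poly_growth f" shows "poly_growth (\<lambda>z. cnj (f z))"
proof (rule poly_growth_dominated[OF _ assms])
  have "continuous_on UNIV cnj" by (intro continuous_intros)
  then show "(\<lambda>z. cnj (f z)) \<in> borel_measurable borel"
    using poly_growth_measurable[OF assms] by (rule borel_measurable_continuous_on)
qed simp

lemma poly_growth_monomial [simp]: "poly_growth (\<lambda>z. plane_complex z ^ a * cnj (plane_complex z) ^ b)"
  by (intro poly_growth_mult poly_growth_power poly_growth_cnj poly_growth_plane_complex)

lemma plane_complex_Pair:
  "plane_complex (q, p) = complex_of_real q + \<i> * complex_of_real p"
  "cnj (plane_complex (q, p)) = complex_of_real q - \<i> * complex_of_real p"
  by (simp_all add: plane_complex_def complex_eq_iff)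

definition plane_moment :: "nat \<Rightarrow> nat \<Rightarrow> complex" where
  "plane_moment a b = (LINT z|gauss_plane. plane_complex z ^ a * cnj (plane_complex z) ^ b)"

text \<open>For frozen \<open>p\<close> the monomial is a polynomial in \<open>q\<close> whose
  derivative lowers either exponent with the same sign. The derivative in \<open>p\<close> brings
  factors i and -i instead, hence the difference in \<open>plane_stein_snd\<close>.\<close>

lemma plane_stein_fst:
  "(LINT z|gauss_plane. complex_of_real (fst z) * (plane_complex z ^ a * cnj (plane_complex z) ^ b))
    = (of_nat a * plane_moment (a - 1) b + of_nat b * plane_moment a (b - 1)) / 2"
proof -
  define P where "P = (\<lambda>p::real. [:\<i> * complex_of_real p, 1:] ^ a * [:- \<i> * complex_of_real p, 1:] ^ b)"
  have P: "plane_complex (q, p) ^ a * cnj (plane_complex (q, p)) ^ b = poly (P p) (complex_of_real q)" for q p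
    by (simp add: P_def plane_complex_Pair poly_power add.commute)
  let ?G = "\<lambda>z. of_nat a * (plane_complex z ^ (a - 1) * cnj (plane_complex z) ^ b)
              + of_nat b * (plane_complex z ^ a * cnj (plane_complex z) ^ (b - 1))"
  have P': "poly (pderiv (P p)) (complex_of_real q) = ?G (q, p)" for q p
    by (simp add: P_def plane_complex_Pair pderiv_mult pderiv_power pderiv_pCons poly_power algebra_simps)
  have "(LINT z|gauss_plane. complex_of_real (fst z) * (plane_complex z ^ a * cnj (plane_complex z) ^ b))
      = (LINT p|lborel. (exp (- p\<^sup>2) / pi) *\<^sub>R
          (LINT q|lborel. exp (- q\<^sup>2) *\<^sub>R (complex_of_real q * poly (P p) (complex_of_real q))))"
    by (subst integral_gauss_fst_inner) (auto simp only: P fst_conv intro!: poly_growth_mult poly_growth_fst poly_growth_monomial)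
  also have "\<dots> = (LINT p|lborel. (exp (- p\<^sup>2) / pi) *\<^sub>R (LINT q|lborel. exp (- q\<^sup>2) *\<^sub>R ?G (q, p))) / 2"
    unfolding gauss_stein P' LINT_scaleR_half ..
  also have "(LINT p|lborel. (exp (- p\<^sup>2) / pi) *\<^sub>R (LINT q|lborel. exp (- q\<^sup>2) *\<^sub>R ?G (q, p))) = integral\<^sup>L gauss_plane ?G"
    by (rule integral_gauss_fst_inner[symmetric])
       (intro poly_growth_add poly_growth_mult poly_growth_const poly_growth_monomial)
  also have "\<dots> = of_nat a * plane_moment (a - 1) b + of_nat b * plane_moment a (b - 1)"
    unfolding plane_moment_def by (simp add: poly_growth_integrable)
  finally show ?thesis .
qed

lemma plane_stein_snd:
  "(LINT z|gauss_plane. complex_of_real (snd z) * (plane_complex z ^ a * cnj (plane_complex z) ^ b))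
    = \<i> * (of_nat a * plane_moment (a - 1) b - of_nat b * plane_moment a (b - 1)) / 2"
proof -
  define P where "P = (\<lambda>q::real. [:complex_of_real q, \<i>:] ^ a * [:complex_of_real q, - \<i>:] ^ b)"
  have P: "plane_complex (q, p) ^ a * cnj (plane_complex (q, p)) ^ b = poly (P q) (complex_of_real p)" for q p
    by (simp add: P_def plane_complex_Pair poly_power mult.commute)
  let ?G = "\<lambda>z. \<i> * of_nat a * (plane_complex z ^ (a - 1) * cnj (plane_complex z) ^ b)
              + (- \<i> * of_nat b) * (plane_complex z ^ a * cnj (plane_complex z) ^ (b - 1))"
  have P': "poly (pderiv (P q)) (complex_of_real p) = ?G (q, p)" for q p
    by (simp add: P_def plane_complex_Pair pderiv_mult pderiv_power pderiv_pCons poly_power algebra_simps)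
  have "(LINT z|gauss_plane. complex_of_real (snd z) * (plane_complex z ^ a * cnj (plane_complex z) ^ b))
      = (LINT q|lborel. (exp (- q\<^sup>2) / pi) *\<^sub>R
          (LINT p|lborel. exp (- p\<^sup>2) *\<^sub>R (complex_of_real p * poly (P q) (complex_of_real p))))"
    by (subst integral_gauss_snd_inner) (auto simp only: P snd_conv intro!: poly_growth_mult poly_growth_snd poly_growth_monomial)
  also have "\<dots> = (LINT q|lborel. (exp (- q\<^sup>2) / pi) *\<^sub>R (LINT p|lborel. exp (- p\<^sup>2) *\<^sub>R ?G (q, p))) / 2"
    unfolding gauss_stein P' LINT_scaleR_half ..
  also have "(LINT q|lborel. (exp (- q\<^sup>2) / pi) *\<^sub>R (LINT p|lborel. exp (- p\<^sup>2) *\<^sub>R ?G (q, p))) = integral\<^sup>L gauss_plane ?G"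
    by (rule integral_gauss_snd_inner[symmetric])
       (intro poly_growth_add poly_growth_mult poly_growth_const poly_growth_monomial)
  also have "\<dots> = \<i> * of_nat a * plane_moment (a - 1) b + (- \<i> * of_nat b) * plane_moment a (b - 1)"
    unfolding plane_moment_def by (simp add: poly_growth_integrable)
  also have "\<dots> / 2 = \<i> * (of_nat a * plane_moment (a - 1) b - of_nat b * plane_moment a (b - 1)) / 2"
    by (simp add: algebra_simps)
  finally show ?thesis .
qed

text \<open>With the extra factor written as q + ip, the terms with \<open>a\<close> in the two
  Stein identities cancel and those with \<open>b\<close> add up.\<close>

lemma plane_moment_Suc: "plane_moment (Suc a) b = of_nat b * plane_moment a (b - 1)"
proof -
  let ?F = "\<lambda>z. plane_complex z ^ a * cnj (plane_complex z) ^ b"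
  have int: "integrable gauss_plane (\<lambda>z. complex_of_real (fst z) * ?F z)"
    "integrable gauss_plane (\<lambda>z. complex_of_real (snd z) * ?F z)"
    using poly_growth_integrable[OF poly_growth_mult[OF poly_growth_fst poly_growth_monomial]]
      poly_growth_integrable[OF poly_growth_mult[OF poly_growth_snd poly_growth_monomial]] by blast+
  have "plane_moment (Suc a) b = (LINT z|gauss_plane. complex_of_real (fst z) * ?F z + \<i> * (complex_of_real (snd z) * ?F z))"
    unfolding plane_moment_def
    by (intro Bochner_Integration.integral_cong) (auto simp: plane_complex_def Complex_eq algebra_simps)
  also have "\<dots> = (LINT z|gauss_plane. complex_of_real (fst z) * ?F z) + \<i> * (LINT z|gauss_plane. complex_of_real (snd z) * ?F z)"
    using int by simp
  also have "\<dots> = of_nat b * plane_moment a (b - 1)"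
    unfolding plane_stein_fst plane_stein_snd by (simp add: field_simps)
  finally show ?thesis .
qed

lemma plane_moment_0_0: "plane_moment 0 0 = 1"
proof -
  have *: "(LINT q|lborel. complex_of_real (exp (- q\<^sup>2))) = complex_of_real (sqrt pi)"
    using LINT_gauss_poly[of 1] gauss_poly_integral_1[of 0] by (simp add: scaleR_conv_of_real)
  have "plane_moment 0 0 = (LINT p|lborel. (exp (- p\<^sup>2) / pi) *\<^sub>R (LINT q|lborel. exp (- q\<^sup>2) *\<^sub>R (1::complex)))"
    unfolding plane_moment_def by (simp only: power_0 mult_1_left) (rule integral_gauss_fst_inner, simp)
  also have "\<dots> = (LINT p|lborel. complex_of_real (exp (- p\<^sup>2)) * complex_of_real (sqrt pi / pi))"
    using * by (simp add: scaleR_conv_of_real)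
  also have "\<dots> = complex_of_real (sqrt pi) * complex_of_real (sqrt pi / pi)"
    by (simp only: integral_mult_left_zero *)
  also have "\<dots> = 1" by (simp flip: of_real_mult)
  finally show ?thesis .
qed

lemma plane_moment_eq: "plane_moment a b = (if a = b then fact a else 0)"
proof (induction a arbitrary: b)
  case 0
  show ?case
  proof (cases b)
    case (Suc c)
    \<comment> \<open>The recursion lowers the first exponent only when it is positive. Conjugation
      swaps the exponents, after which the factor \<open>of_nat 0\<close> gives 0.\<close>
    have "plane_moment 0 b = cnj (plane_moment b 0)"
      unfolding plane_moment_def by (simp flip: Bochner_Integration.integral_cnj)
    also have "\<dots> = 0" using Suc by (simp add: plane_moment_Suc)
    finally show ?thesis using Suc by simp
  qed (simp add: plane_moment_0_0)
next
  case (Suc a)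
  then show ?case by (cases b) (auto simp: plane_moment_Suc)
qed

section \<open>Moments of the perturbation and expansion of the entropy integrand\<close>

lemma poly_growth_norm [simp]: "poly_growth (norm :: real \<times> real \<Rightarrow> real)"
  by (rule poly_growth_norm_bound) auto

lemma poly_growth_Re:
  assumes "poly_growth f" shows "poly_growth (\<lambda>z. Re (f z))"
proof (rule poly_growth_dominated[OF _ assms])
  have "continuous_on UNIV Re" by (intro continuous_intros)
  then show "(\<lambda>z. Re (f z)) \<in> borel_measurable borel"
    using poly_growth_measurable[OF assms] by (rule borel_measurable_continuous_on)
qed (simp add: abs_Re_le_cmod)

lemma coherence_ratio_eq: "coherence_ratio n z = 2 * sqrt (2 ^ n / fact n) * Re (plane_complex z ^ n)"
  by (simp add: coherence_ratio_def plane_complex_def)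

lemma poly_growth_coherence_ratio [simp]: "poly_growth (coherence_ratio n)"
  unfolding coherence_ratio_eq[abs_def]
  by (intro poly_growth_mult poly_growth_const poly_growth_Re poly_growth_power poly_growth_plane_complex)

lemma poly_growth_population_ratio [simp]: "poly_growth (population_ratio n)"
  unfolding population_ratio_def[abs_def]
  by (intro poly_growth_sum poly_growth_mult poly_growth_const poly_growth_power poly_growth_norm)

lemma of_real_coherence_ratio:
  "complex_of_real (coherence_ratio n z)
     = complex_of_real (sqrt (2 ^ n / fact n)) * (plane_complex z ^ n + cnj (plane_complex z) ^ n)"
proof -
  have "plane_complex z ^ n + cnj (plane_complex z) ^ n = complex_of_real (2 * Re (plane_complex z ^ n))"
    using complex_add_cnj[of "plane_complex z ^ n"] by simp
  then show ?thesis by (simp add: coherence_ratio_eq)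
qed

lemma of_real_norm_plane:
  "complex_of_real (norm z ^ (2 * k)) = plane_complex z ^ k * cnj (plane_complex z) ^ k"
proof -
  have "complex_of_real ((norm z)\<^sup>2) = plane_complex z * cnj (plane_complex z)"
    unfolding norm_plane_complex[symmetric] by (rule complex_norm_square)
  then show ?thesis by (simp only: power_mult of_real_power power_mult_distrib)
qed

lemma norm_moment: "(LINT z|gauss_plane. norm z ^ (2 * k)) = fact k"
proof -
  have "complex_of_real (LINT z|gauss_plane. norm z ^ (2 * k)) = plane_moment k k"
    unfolding plane_moment_def by (simp only: integral_complex_of_real[symmetric] of_real_norm_plane)
  then have "complex_of_real (LINT z|gauss_plane. norm z ^ (2 * k)) = complex_of_real (fact k)"
    by (simp add: plane_moment_eq)
  then show ?thesis by (simp only: of_real_eq_iff)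
qed

text \<open>The exponents of each monomial differ by n, so both moments vanish.\<close>

lemma coherence_norm_moment:
  assumes "1 \<le> n"
  shows "(LINT z|gauss_plane. coherence_ratio n z * norm z ^ (2 * k)) = 0"
proof -
  let ?A = "complex_of_real (sqrt (2 ^ n / fact n))"
  have eq: "complex_of_real (coherence_ratio n z * norm z ^ (2 * k))
      = ?A * (plane_complex z ^ (n + k) * cnj (plane_complex z) ^ k)
        + ?A * (plane_complex z ^ k * cnj (plane_complex z) ^ (n + k))" for z
    unfolding of_real_mult of_real_coherence_ratio of_real_norm_plane by (simp add: algebra_simps power_add)
  have "complex_of_real (LINT z|gauss_plane. coherence_ratio n z * norm z ^ (2 * k))
      = ?A * plane_moment (n + k) k + ?A * plane_moment k (n + k)"
    unfolding plane_moment_def integral_complex_of_real[symmetric] eq by (simp add: poly_growth_integrable)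
  also have "\<dots> = 0" using assms by (simp add: plane_moment_eq)
  finally show ?thesis by simp
qed

lemma power_double: "x ^ (2 * n) = (x ^ n)\<^sup>2" and power_triple: "x ^ (3 * n) = (x ^ n) ^ 3"
  for x :: "'a::monoid_mult"
  by (metis mult.commute power_mult)+

text \<open>Only the cross term has equal exponents; its moment n! cancels the 1 / n! of the squared
  prefactor.\<close>

lemma coherence_square_moment:
  assumes "1 \<le> n"
  shows "(LINT z|gauss_plane. (coherence_ratio n z)\<^sup>2) = 2 * 2 ^ n"
proof -
  let ?A = "complex_of_real (2 ^ n / fact n)"
  have A: "(complex_of_real (sqrt (2 ^ n / fact n)))\<^sup>2 = ?A"
    unfolding of_real_power[symmetric] by simp
  have eq: "complex_of_real ((coherence_ratio n z)\<^sup>2)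
      = ?A * (plane_complex z ^ (2 * n) * cnj (plane_complex z) ^ 0)
        + 2 * ?A * (plane_complex z ^ n * cnj (plane_complex z) ^ n)
        + ?A * (plane_complex z ^ 0 * cnj (plane_complex z) ^ (2 * n))" for z
    unfolding of_real_power of_real_coherence_ratio power_mult_distrib A power_double power_0
    by (simp add: power2_sum distrib_left mult_ac)
  have "complex_of_real (LINT z|gauss_plane. (coherence_ratio n z)\<^sup>2)
      = ?A * plane_moment (2 * n) 0 + 2 * ?A * plane_moment n n + ?A * plane_moment 0 (2 * n)"
    unfolding plane_moment_def integral_complex_of_real[symmetric] eq
    by (simp add: poly_growth_integrable del: power_0)
  also have "\<dots> = complex_of_real (2 * 2 ^ n)" using assms by (simp add: plane_moment_eq)
  finally show ?thesis by (simp only: of_real_eq_iff)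
qed

text \<open>The exponent pairs (3n, 0), (2n, n), (n, 2n), (0, 3n) are never balanced.\<close>

lemma coherence_cube_moment:
  assumes "1 \<le> n"
  shows "(LINT z|gauss_plane. coherence_ratio n z ^ 3) = 0"
proof -
  let ?A = "complex_of_real (sqrt (2 ^ n / fact n)) ^ 3"
  have eq: "complex_of_real (coherence_ratio n z ^ 3)
      = ?A * (plane_complex z ^ (3 * n) * cnj (plane_complex z) ^ 0)
        + 3 * ?A * (plane_complex z ^ (2 * n) * cnj (plane_complex z) ^ n)
        + 3 * ?A * (plane_complex z ^ n * cnj (plane_complex z) ^ (2 * n))
        + ?A * (plane_complex z ^ 0 * cnj (plane_complex z) ^ (3 * n))" for z
  proof -
    have cube: "(a + b) ^ 3 = a ^ 3 + 3 * (a\<^sup>2 * b) + 3 * (a * b\<^sup>2) + b ^ 3" for a b :: complex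
      by (simp add: power2_eq_square power3_eq_cube algebra_simps)
    show ?thesis
      unfolding of_real_power of_real_coherence_ratio power_mult_distrib cube power_double power_triple power_0
      by (simp add: distrib_left mult_ac)
  qed
  have "complex_of_real (LINT z|gauss_plane. coherence_ratio n z ^ 3)
      = ?A * plane_moment (3 * n) 0 + 3 * ?A * plane_moment (2 * n) n
        + 3 * ?A * plane_moment n (2 * n) + ?A * plane_moment 0 (3 * n)"
    unfolding plane_moment_def integral_complex_of_real[symmetric] eq
    by (simp add: poly_growth_integrable del: power_0)
  also have "\<dots> = 0" using assms by (simp add: plane_moment_eq)
  finally show ?thesis by simp
qed

lemma population_norm_moment:
  "(LINT z|gauss_plane. population_ratio n z * norm z ^ (2 * j))
     = (\<Sum>k\<le>n. (-1) ^ (n - k) * 2 ^ k * real (n choose k) / fact k * fact (k + j))"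
proof -
  have "(LINT z|gauss_plane. population_ratio n z * norm z ^ (2 * j))
      = (LINT z|gauss_plane. (\<Sum>k\<le>n. (-1) ^ (n - k) * 2 ^ k * real (n choose k) / fact k * norm z ^ (2 * (k + j))))"
    by (simp add: population_ratio_def sum_distrib_right power_add distrib_left mult.assoc)
  also have "\<dots> = (\<Sum>k\<le>n. (LINT z|gauss_plane. (-1) ^ (n - k) * 2 ^ k * real (n choose k) / fact k * norm z ^ (2 * (k + j))))"
    by (intro Bochner_Integration.integral_sum poly_growth_integrable poly_growth_mult poly_growth_const
        poly_growth_power poly_growth_norm)
  also have "\<dots> = (\<Sum>k\<le>n. (-1) ^ (n - k) * 2 ^ k * real (n choose k) / fact k * fact (k + j))"
    by (simp only: integral_mult_right_zero norm_moment)
  finally show ?thesis .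
qed

text \<open>The binomial sum (2 - 1)^n expresses the unit trace of |n><n|.\<close>

lemma population_moment: "(LINT z|gauss_plane. population_ratio n z) = 1"
proof -
  have "(LINT z|gauss_plane. population_ratio n z) = (\<Sum>k\<le>n. real (n choose k) * 2 ^ k * (-1) ^ (n - k))"
    using population_norm_moment[of n 0] by (simp add: mult_ac)
  also have "\<dots> = (2 + (-1)) ^ n" by (rule binomial_ring[symmetric])
  finally show ?thesis by simp
qed

text \<open>The expectation of q^2 + p^2 in the number state. Since
  \<open>fact (k + 1) / fact k\<close> is k + 1, the sum splits into the unit mass and a binomial
  sum weighted by k.\<close>

lemma population_energy: "(LINT z|gauss_plane. population_ratio n z * (norm z)\<^sup>2) = 2 * real n + 1"
proof -
  have "(LINT z|gauss_plane. population_ratio n z * (norm z)\<^sup>2)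
      = (\<Sum>k\<le>n. (-1) ^ (n - k) * 2 ^ k * real (n choose k) / fact k * fact (k + 1))"
    using population_norm_moment[of n 1] by simp
  also have "\<dots> = (\<Sum>k\<le>n. real (n choose k) * 2 ^ k * (-1) ^ (n - k) + real k * real (n choose k) * 2 ^ k * (-1) ^ (n - k))"
    by (intro sum.cong) (simp_all add: field_simps)
  also have "\<dots> = (\<Sum>k\<le>n. real (n choose k) * 2 ^ k * (-1) ^ (n - k)) + (\<Sum>k\<le>n. real k * real (n choose k) * 2 ^ k * (-1) ^ (n - k))"
    by (rule sum.distrib)
  also have "(\<Sum>k\<le>n. real (n choose k) * 2 ^ k * (-1) ^ (n - k)) = (2 + (-1)) ^ n"
    by (rule binomial_ring[symmetric])
  also have "(\<Sum>k\<le>n. real k * real (n choose k) * 2 ^ k * (-1) ^ (n - k)) = 2 * real n"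
  proof (cases n)
    case (Suc m)
    \<comment> \<open>Absorption turns the weighted sum into 2n (2 - 1)^(n-1).\<close>
    have "real (Suc k) * real (n choose Suc k) = real n * real (m choose k)" for k
      using binomial_absorption[of k n] Suc by (metis diff_Suc_1 of_nat_mult)
    then have "(\<Sum>k\<le>m. real (Suc k) * real (n choose Suc k) * 2 ^ Suc k * (-1) ^ (n - Suc k))
        = (\<Sum>k\<le>m. 2 * real n * (real (m choose k) * 2 ^ k * (-1) ^ (m - k)))"
      using Suc by (intro sum.cong) (simp_all only: diff_Suc_Suc power_Suc mult_ac)
    also have "\<dots> = 2 * real n * (2 + (-1)) ^ m"
      by (simp only: sum_distrib_left[symmetric] binomial_ring[of 2 "-1::real" m])
    finally show ?thesis unfolding Suc sum.atMost_Suc_shift by simp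
  qed simp
  finally show ?thesis by simp
qed

text \<open>The population part combines even powers of the norm, against each of which the
  coherence part integrates to 0.\<close>

lemma coherence_population_moment:
  assumes "1 \<le> n"
  shows "(LINT z|gauss_plane. coherence_ratio n z * population_ratio n z) = 0"
proof -
  define d where "d = (\<lambda>k. (-1) ^ (n - k) * 2 ^ k * real (n choose k) / fact k :: real)"
  have "(LINT z|gauss_plane. coherence_ratio n z * population_ratio n z)
      = (LINT z|gauss_plane. (\<Sum>k\<le>n. d k * (coherence_ratio n z * norm z ^ (2 * k))))"
    by (simp add: population_ratio_def d_def sum_distrib_left mult_ac)
  also have "\<dots> = (\<Sum>k\<le>n. (LINT z|gauss_plane. d k * (coherence_ratio n z * norm z ^ (2 * k))))"
    by (intro Bochner_Integration.integral_sum poly_growth_integrable poly_growth_mult poly_growth_const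
        poly_growth_power poly_growth_norm poly_growth_coherence_ratio)
  also have "\<dots> = 0"
    by (simp only: integral_mult_right_zero coherence_norm_moment[OF assms]) simp
  finally show ?thesis .
qed

section \<open>Global two-sided bounds for (1 + u) ln (1 + u)\<close>

lemma ln_one_plus_le_cubic:
  fixes u :: real
  assumes "-1 < u"
  shows "ln (1 + u) \<le> u - u\<^sup>2 / 2 + u ^ 3 / 3"
proof -
  define f where "f = (\<lambda>x::real. x - x\<^sup>2 / 2 + x ^ 3 / 3 - ln (1 + x))"
  \<comment> \<open>Stopping the series at odd degree makes the derivative change sign at 0, so 0 is
    the minimum and one inequality covers both signs of \<open>u\<close>.\<close>
  have f': "(f has_real_derivative x ^ 3 / (1 + x)) (at x)" if "-1 < x" for x
    unfolding f_def using that
    by (auto intro!: derivative_eq_intros simp: field_simps power2_eq_square power3_eq_cube)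
  have "f 0 \<le> f u"
  proof (cases "0 \<le> u")
    case True
    then show ?thesis
    proof (rule DERIV_nonneg_imp_nondecreasing)
      fix x assume "0 \<le> x" "x \<le> u"
      then show "\<exists>y. (f has_real_derivative y) (at x) \<and> 0 \<le> y"
        using f'[of x] by (intro exI[of _ "x ^ 3 / (1 + x)"]) auto
    qed
  next
    case False
    then have "u \<le> 0" by simp
    then show ?thesis
    proof (rule DERIV_nonpos_imp_nonincreasing)
      fix x assume "u \<le> x" "x \<le> 0"
      then show "\<exists>y. (f has_real_derivative y) (at x) \<and> y \<le> 0"
        using f'[of x] assms
        by (intro exI[of _ "x ^ 3 / (1 + x)"]) (auto intro!: divide_nonpos_pos simp: power_le_zero_eq)
    qed
  qed
  then show ?thesis by (simp add: f_def)
qed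

text \<open>Division by 1 + x isolates the logarithm; the difference then has the rational
  derivative x^3 / (3 (1 + x)^2), which has the sign of x.\<close>

lemma xlnx_ge_cubic:
  fixes u :: real
  assumes "-1 < u"
  shows "u + u\<^sup>2 / 2 - u ^ 3 / 6 \<le> (1 + u) * ln (1 + u)"
proof -
  define f where "f = (\<lambda>x::real. ln (1 + x) - (x + x\<^sup>2 / 2 - x ^ 3 / 6) / (1 + x))"
  have f': "(f has_real_derivative x ^ 3 / 3 / (1 + x)\<^sup>2) (at x)" if "-1 < x" for x
  proof -
    have "(f has_real_derivative 1 / (1 + x)
        - ((1 + x - x\<^sup>2 / 2) * (1 + x) - (x + x\<^sup>2 / 2 - x ^ 3 / 6)) / ((1 + x) * (1 + x))) (at x)"
      unfolding f_def using that by (auto intro!: derivative_eq_intros)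
    moreover have "1 / (1 + x) - ((1 + x - x\<^sup>2 / 2) * (1 + x) - (x + x\<^sup>2 / 2 - x ^ 3 / 6)) / ((1 + x) * (1 + x))
        = x ^ 3 / 3 / (1 + x)\<^sup>2"
    proof -
      have "1 / (1 + x) = (1 + x) / ((1 + x) * (1 + x))" using that by simp
      moreover have "(1 + x) - ((1 + x - x\<^sup>2 / 2) * (1 + x) - (x + x\<^sup>2 / 2 - x ^ 3 / 6)) = x ^ 3 / 3"
        by (simp add: power2_eq_square power3_eq_cube field_simps)
      ultimately show ?thesis
        by (simp only: diff_divide_distrib[symmetric] power2_eq_square)
    qed
    ultimately show ?thesis by simp
  qed
  have "f 0 \<le> f u"
  proof (cases "0 \<le> u")
    case True
    then show ?thesis
    proof (rule DERIV_nonneg_imp_nondecreasing)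
      fix x assume "0 \<le> x" "x \<le> u"
      then show "\<exists>y. (f has_real_derivative y) (at x) \<and> 0 \<le> y"
        using f'[of x] by (intro exI[of _ "x ^ 3 / 3 / (1 + x)\<^sup>2"]) auto
    qed
  next
    case False
    then have "u \<le> 0" by simp
    then show ?thesis
    proof (rule DERIV_nonpos_imp_nonincreasing)
      fix x assume "u \<le> x" "x \<le> 0"
      then show "\<exists>y. (f has_real_derivative y) (at x) \<and> y \<le> 0"
        using f'[of x] assms
        by (intro exI[of _ "x ^ 3 / 3 / (1 + x)\<^sup>2"]) (auto intro!: divide_nonpos_pos simp: power_le_zero_eq)
    qed
  qed
  then show ?thesis using assms by (simp add: f_def pos_divide_le_eq mult.commute)
qed

text \<open>Multiplying the cubic bound by 1 + u reproduces the lower bound exactly up to degree 3,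
  leaving the gap u^4 / 3.\<close>

lemma xlnx_le_quartic:
  fixes u :: real
  assumes "-1 < u"
  shows "(1 + u) * ln (1 + u) \<le> u + u\<^sup>2 / 2 - u ^ 3 / 6 + u ^ 4 / 3"
proof -
  have "(1 + u) * ln (1 + u) \<le> (1 + u) * (u - u\<^sup>2 / 2 + u ^ 3 / 3)"
    using assms by (intro mult_left_mono ln_one_plus_le_cubic) auto
  also have "\<dots> = u + u\<^sup>2 / 2 - u ^ 3 / 6 + u ^ 4 / 3"
    by (simp add: field_simps power2_eq_square power3_eq_cube power4_eq_xxxx)
  finally show ?thesis .
qed

section \<open>Positivity and the entropy expansion\<close>

definition wigner_perturbation :: "nat \<Rightarrow> real \<Rightarrow> real \<Rightarrow> real \<times> real \<Rightarrow> real" where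
  "wigner_perturbation n l t z = l * t * coherence_ratio n z + t\<^sup>2 * population_ratio n z"

lemma wigner_sigma_state_perturbation:
  "wigner (sigma_state n t l) (fst z) (snd z)
     = exp (- (norm z)\<^sup>2) / pi * ((1 + wigner_perturbation n l t z) / (1 + t\<^sup>2))"
  by (simp add: wigner_sigma_state wigner_perturbation_def add.assoc)

lemma poly_growth_perturbation [simp]: "poly_growth (wigner_perturbation n l t)"
  unfolding wigner_perturbation_def[abs_def]
  by (intro poly_growth_add poly_growth_mult poly_growth_const poly_growth_coherence_ratio
      poly_growth_population_ratio)

text \<open>Up to \<open>R\<close> the sum is at most its value there; beyond \<open>R\<close> every
  power is at most x^(n-1) and the coefficient sum is at most \<open>\<delta> * x\<close>. It serves
  to absorb the lower terms of the population part.\<close>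

lemma sum_lower_powers_bound:
  fixes c :: "nat \<Rightarrow> real"
  assumes "0 < \<delta>"
  shows "\<exists>B. \<forall>x\<ge>0. (\<Sum>k<n. \<bar>c k\<bar> * x ^ k) \<le> \<delta> * x ^ n + B"
proof -
  define D where "D = (\<Sum>k<n. \<bar>c k\<bar>)"
  define R where "R = max 1 (D / \<delta>)"
  define B where "B = (\<Sum>k<n. \<bar>c k\<bar> * R ^ k)"
  have R: "1 \<le> R" "D \<le> \<delta> * R"
    using assms by (auto simp: R_def max_def field_simps)
  have B: "0 \<le> B" unfolding B_def using R(1) by (intro sum_nonneg) auto
  have "(\<Sum>k<n. \<bar>c k\<bar> * x ^ k) \<le> \<delta> * x ^ n + B" if x: "0 \<le> x" for x
  proof (cases "x \<le> R")
    case True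
    then have "(\<Sum>k<n. \<bar>c k\<bar> * x ^ k) \<le> B"
      unfolding B_def using x by (intro sum_mono mult_left_mono power_mono) auto
    moreover have "0 \<le> \<delta> * x ^ n" using assms x by simp
    ultimately show ?thesis by simp
  next
    case False
    show ?thesis
    proof (cases n)
      case 0
      then show ?thesis using assms B by simp
    next
      case (Suc m)
      have "(\<Sum>k<n. \<bar>c k\<bar> * x ^ k) \<le> (\<Sum>k<n. \<bar>c k\<bar> * x ^ m)"
        using False R(1) Suc by (intro sum_mono mult_left_mono power_increasing) auto
      also have "\<dots> = D * x ^ m" by (simp add: D_def sum_distrib_right)
      also have "\<dots> \<le> (\<delta> * x) * x ^ m"
        using False R assms x by (intro mult_right_mono order_trans[OF R(2)] mult_left_mono) auto
      finally show ?thesis using B Suc by (simp add: mult.assoc)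
    qed
  qed
  then show ?thesis by blast
qed

text \<open>The cross term is absorbed by \<open>1\<close> and the leading term of the population part, up to a
  factor \<open>l < 1\<close>; the remaining margin \<open>1 - l\<close> dominates the lower-order terms.\<close>

lemma perturbation_positive:
  assumes "0 \<le> l" "l < 1"
  shows "\<exists>t0>0. \<forall>t. \<bar>t\<bar> \<le> t0 \<longrightarrow> (\<forall>z. 0 < 1 + wigner_perturbation n l t z)"
proof -
  define K where "K = (2 ^ n / fact n :: real)"
  define d where "d = (\<lambda>k. (-1) ^ (n - k) * 2 ^ k * real (n choose k) / fact k :: real)"
  have K: "0 < K" by (simp add: K_def)
  have dn: "d n = K" by (simp add: d_def K_def)
  have pop: "population_ratio n z = K * norm z ^ (2 * n) + (\<Sum>k<n. d k * norm z ^ (2 * k))" for z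
  proof -
    have "population_ratio n z = (\<Sum>k\<le>n. d k * norm z ^ (2 * k))"
      by (simp add: population_ratio_def d_def)
    then show ?thesis by (simp add: lessThan_Suc_atMost[symmetric] dn)
  qed
  \<comment> \<open>A fraction \<open>1 - l\<close> of the leading term is spent on the lower
    powers; the fraction \<open>l\<close> remains for the cross term.\<close>
  obtain B where B: "\<And>x. 0 \<le> x \<Longrightarrow> (\<Sum>k<n. \<bar>d k\<bar> * x ^ k) \<le> ((1 - l) * K) * x ^ n + B"
    using sum_lower_powers_bound[where \<delta> = "(1 - l) * K" and n = n and c = d] assms K by auto
  \<comment> \<open>Chosen so that the constant left over costs at most half of the margin
    \<open>1 - l\<close>; the added 1 keeps the denominator positive.\<close>
  define t0 where "t0 = sqrt ((1 - l) / (2 * (\<bar>B\<bar> + 1)))"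
  have t0: "0 < t0" "t0\<^sup>2 * (\<bar>B\<bar> + 1) = (1 - l) / 2"
    using assms by (auto simp: t0_def field_simps)
  have "0 < 1 + wigner_perturbation n l t z" if t: "\<bar>t\<bar> \<le> t0" for t z
  proof -
    \<comment> \<open>\<open>y^2\<close> is exactly the leading population term and
      \<open>2 * y\<close> bounds the coherence term, so that \<open>2 * y \<le> 1 + y^2\<close>
      compares them.\<close>
    define y where "y = \<bar>t\<bar> * sqrt K * norm z ^ n"
    have y2: "y\<^sup>2 = t\<^sup>2 * K * norm z ^ (2 * n)"
      using K by (simp add: y_def power_mult_distrib power_double)
    have "\<bar>Re (plane_complex z ^ n)\<bar> \<le> norm z ^ n"
      by (metis abs_Re_le_cmod norm_plane_complex norm_power)
    then have "\<bar>t * coherence_ratio n z\<bar> \<le> 2 * y"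
      unfolding coherence_ratio_eq K_def[symmetric] y_def abs_mult
      using K by (simp add: mult_left_mono mult.assoc mult.left_commute)
    also have "2 * y \<le> 1 + y\<^sup>2"
      using zero_le_power2[of "y - 1"] by (simp add: power2_diff)
    finally have "\<bar>l * (t * coherence_ratio n z)\<bar> \<le> l * (1 + y\<^sup>2)"
      unfolding abs_mult[of l] using assms(1) by (simp add: mult_left_mono)
    then have coh: "- (l * (1 + y\<^sup>2)) \<le> l * t * coherence_ratio n z"
      by (simp add: mult.assoc)
    have "\<bar>\<Sum>k<n. d k * norm z ^ (2 * k)\<bar> \<le> (\<Sum>k<n. \<bar>d k\<bar> * ((norm z)\<^sup>2) ^ k)"
      by (rule order_trans[OF sum_abs]) (simp add: abs_mult power_mult)
    also have "\<dots> \<le> ((1 - l) * K) * ((norm z)\<^sup>2) ^ n + B"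
      by (rule B) simp
    finally have low: "- (((1 - l) * K) * norm z ^ (2 * n) + \<bar>B\<bar>) \<le> (\<Sum>k<n. d k * norm z ^ (2 * k))"
      by (simp add: power_mult)
    have "t\<^sup>2 * population_ratio n z \<ge> t\<^sup>2 * (K * norm z ^ (2 * n) - (((1 - l) * K) * norm z ^ (2 * n) + \<bar>B\<bar>))"
      unfolding pop using low by (intro mult_left_mono) auto
    then have "t\<^sup>2 * population_ratio n z \<ge> l * y\<^sup>2 - t\<^sup>2 * \<bar>B\<bar>"
      unfolding y2 by (simp add: algebra_simps)
    moreover have "t\<^sup>2 * \<bar>B\<bar> \<le> t0\<^sup>2 * (\<bar>B\<bar> + 1)"
      using t t0(1) by (intro mult_mono) (auto simp: abs_le_square_iff[symmetric])
    ultimately have "1 + wigner_perturbation n l t z \<ge> 1 - l * (1 + y\<^sup>2) + (l * y\<^sup>2 - (1 - l) / 2)"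
      unfolding wigner_perturbation_def using coh t0(2) by linarith
    moreover have "1 - l * (1 + y\<^sup>2) + (l * y\<^sup>2 - (1 - l) / 2) = (1 - l) / 2"
      by (simp add: field_simps)
    moreover have "0 < (1 - l) / 2" using assms(2) by simp
    ultimately show ?thesis by (metis less_le_trans)
  qed
  with t0(1) show ?thesis by blast
qed

section \<open>Entropy of the perturbed Gaussian\<close>

lemma perturbation_mean: "1 \<le> n \<Longrightarrow> (LINT z|gauss_plane. wigner_perturbation n l t z) = t\<^sup>2"
  using coherence_norm_moment[of n 0] population_moment[of n]
  by (simp add: wigner_perturbation_def poly_growth_integrable)

lemma perturbation_energy:
  assumes "1 \<le> n"
  shows "(LINT z|gauss_plane. (1 + wigner_perturbation n l t z) * (norm z)\<^sup>2) = 1 + t\<^sup>2 * (2 * real n + 1)"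
proof -
  have int: "integrable gauss_plane (\<lambda>z. (norm z)\<^sup>2)"
    "integrable gauss_plane (\<lambda>z. coherence_ratio n z * (norm z)\<^sup>2)"
    "integrable gauss_plane (\<lambda>z. population_ratio n z * (norm z)\<^sup>2)"
    by (rule poly_growth_integrable, intro poly_growth_mult poly_growth_power poly_growth_norm
        poly_growth_coherence_ratio poly_growth_population_ratio)+
  have "(LINT z|gauss_plane. (1 + wigner_perturbation n l t z) * (norm z)\<^sup>2)
      = (LINT z|gauss_plane. (norm z)\<^sup>2 + l * t * (coherence_ratio n z * (norm z)\<^sup>2)
           + t\<^sup>2 * (population_ratio n z * (norm z)\<^sup>2))"
    by (simp add: wigner_perturbation_def algebra_simps)
  also have "\<dots> = (LINT z|gauss_plane. (norm z)\<^sup>2) + l * t * (LINT z|gauss_plane. coherence_ratio n z * (norm z)\<^sup>2)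
           + t\<^sup>2 * (LINT z|gauss_plane. population_ratio n z * (norm z)\<^sup>2)"
    using int by simp
  finally show ?thesis
    using norm_moment[of 1] coherence_norm_moment[OF assms, of 1] population_energy[of n] by simp
qed

text \<open>Writing \<open>u = t * v\<close> exposes the powers of \<open>t\<close>. The second
  moment of \<open>v\<close> has no linear term in \<open>t\<close> and the third has no constant
  term, so the error starts at \<open>t ^ 4\<close>; its coefficient is bounded uniformly for
  \<open>\<bar>t\<bar> \<le> 1\<close>, which makes \<open>M\<close> independent of
  \<open>t\<close>.\<close>

lemma perturbation_relative_entropy:
  assumes "1 \<le> n"
  shows "\<exists>M. \<forall>t. \<bar>t\<bar> \<le> 1 \<longrightarrow> (\<forall>z. 0 < 1 + wigner_perturbation n l t z) \<longrightarrow>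
     integrable gauss_plane (\<lambda>z. (1 + wigner_perturbation n l t z) * ln (1 + wigner_perturbation n l t z)) \<and>
     \<bar>(LINT z|gauss_plane. (1 + wigner_perturbation n l t z) * ln (1 + wigner_perturbation n l t z))
        - (t\<^sup>2 + 2 ^ n * l\<^sup>2 * t\<^sup>2)\<bar> \<le> M * t ^ 4"
proof -
  let ?C = "coherence_ratio n" and ?L = "population_ratio n"
  define v where "v = (\<lambda>t z. l * ?C z + t * ?L z)"
  have u: "wigner_perturbation n l t z = t * v t z" for t z
    by (simp add: wigner_perturbation_def v_def power2_eq_square algebra_simps)
  have pg [simp]: "poly_growth (v t)" for t
    unfolding v_def by (intro poly_growth_add poly_growth_mult poly_growth_const
        poly_growth_coherence_ratio poly_growth_population_ratio)
  define f where "f = (\<lambda>i j z. ?C z ^ i * ?L z ^ j)"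
  have int [simp]: "integrable gauss_plane (f i j)" for i j
    unfolding f_def by (intro poly_growth_integrable poly_growth_mult poly_growth_power
        poly_growth_coherence_ratio poly_growth_population_ratio)
  define m where "m = (\<lambda>i j. integral\<^sup>L gauss_plane (f i j))"
  have m: "m 2 0 = 2 * 2 ^ n" "m 3 0 = 0" "m 1 1 = 0"
    using coherence_square_moment[OF assms] coherence_cube_moment[OF assms]
      coherence_population_moment[OF assms] by (simp_all add: m_def f_def)
  have v2: "(LINT z|gauss_plane. v t z ^ 2) = l\<^sup>2 * (2 * 2 ^ n) + t\<^sup>2 * m 0 2" for t
  proof -
    have "(LINT z|gauss_plane. v t z ^ 2)
        = (LINT z|gauss_plane. l\<^sup>2 * (f 2 0 z) + 2 * l * t * (f 1 1 z) + t\<^sup>2 * (f 0 2 z))"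
      by (intro Bochner_Integration.integral_cong) (simp_all add: v_def f_def power2_eq_square algebra_simps)
    also have "\<dots> = l\<^sup>2 * m 2 0 + 2 * l * t * m 1 1 + t\<^sup>2 * m 0 2"
      unfolding m_def by simp
    finally show ?thesis by (simp add: m m[simplified])
  qed
  have v3: "(LINT z|gauss_plane. v t z ^ 3) = t * (3 * l\<^sup>2 * m 2 1 + 3 * l * t * m 1 2 + t\<^sup>2 * m 0 3)" for t
  proof -
    have "(LINT z|gauss_plane. v t z ^ 3)
        = (LINT z|gauss_plane. l ^ 3 * (f 3 0 z) + 3 * l\<^sup>2 * t * (f 2 1 z)
            + 3 * l * t\<^sup>2 * (f 1 2 z) + t ^ 3 * (f 0 3 z))"
      by (intro Bochner_Integration.integral_cong)
         (simp_all add: v_def f_def power2_eq_square power3_eq_cube algebra_simps)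
    also have "\<dots> = l ^ 3 * m 3 0 + 3 * l\<^sup>2 * t * m 2 1 + 3 * l * t\<^sup>2 * m 1 2 + t ^ 3 * m 0 3"
      unfolding m_def by simp
    finally show ?thesis by (simp add: m power2_eq_square power3_eq_cube algebra_simps)
  qed
  have v4: "(LINT z|gauss_plane. v t z ^ 4) \<le> 8 * (l ^ 4 * m 4 0 + m 0 4)" if t: "\<bar>t\<bar> \<le> 1" for t
  proof -
    \<comment> \<open>This decouples the coherence and population parts, so only pure fourth moments
      are left.\<close>
    have quartic: "(a + b) ^ 4 \<le> 8 * (a ^ 4 + b ^ 4)" for a b :: real
    proof -
      have sq: "(x + y)\<^sup>2 \<le> 2 * (x\<^sup>2 + y\<^sup>2)" for x y :: real
        using zero_le_power2[of "x - y"] by (simp add: power2_diff power2_sum)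
      have "((a + b)\<^sup>2)\<^sup>2 \<le> (2 * (a\<^sup>2 + b\<^sup>2))\<^sup>2" by (intro power_mono sq) simp
      also have "\<dots> \<le> 4 * (2 * ((a\<^sup>2)\<^sup>2 + (b\<^sup>2)\<^sup>2))" using sq[of "a\<^sup>2" "b\<^sup>2"] unfolding power_mult_distrib by simp
      finally show ?thesis by simp
    qed
    have "(LINT z|gauss_plane. v t z ^ 4) \<le> (LINT z|gauss_plane. 8 * (l ^ 4 * f 4 0 z + f 0 4 z))"
    proof (rule integral_mono)
      fix z
      have "t ^ 4 \<le> 1" using t by (metis abs_ge_zero power_even_abs_numeral power_le_one even_numeral)
      then have "t ^ 4 * ?L z ^ 4 \<le> ?L z ^ 4" by (simp add: mult_left_le_one_le)
      then show "v t z ^ 4 \<le> 8 * (l ^ 4 * f 4 0 z + f 0 4 z)"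
        using quartic[of "l * ?C z" "t * ?L z"] by (simp add: v_def f_def power_mult_distrib)
    qed (auto intro!: poly_growth_integrable poly_growth_power pg)
    also have "\<dots> = 8 * (l ^ 4 * m 4 0 + m 0 4)"
      unfolding m_def by simp
    finally show ?thesis .
  qed
  define M where "M = \<bar>m 0 2\<bar> + (3 * l\<^sup>2 * \<bar>m 2 1\<bar> + 3 * \<bar>l\<bar> * \<bar>m 1 2\<bar> + \<bar>m 0 3\<bar>) + 8 * (l ^ 4 * m 4 0 + m 0 4)"
  show ?thesis
  proof (intro exI[of _ M] allI impI)
    fix t :: real assume t: "\<bar>t\<bar> \<le> 1" and pos: "\<forall>z. 0 < 1 + wigner_perturbation n l t z"
    let ?u = "wigner_perturbation n l t"
    let ?p = "\<lambda>z. ?u z + ?u z ^ 2 / 2 - ?u z ^ 3 / 6"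
    let ?g = "\<lambda>z. (1 + ?u z) * ln (1 + ?u z) - ?p z"
    have g: "0 \<le> ?g z" "?g z \<le> ?u z ^ 4 / 3" for z
      using xlnx_ge_cubic[of "?u z"] xlnx_le_quartic[of "?u z"] pos[rule_format, of z] by auto
    have "poly_growth (\<lambda>z. ?u z + ?u z ^ 2 * (1/2) + ?u z ^ 3 * (-1/6))"
      by (intro poly_growth_add poly_growth_mult poly_growth_power poly_growth_const poly_growth_perturbation)
    then have pg_p: "poly_growth ?p" by simp
    have [measurable]: "?u \<in> borel_measurable borel" by (rule poly_growth_measurable) simp
    \<comment> \<open>Only \<open>1 + u > 0\<close> is available here, without a lower margin;
      squeezing the remainder below a power of \<open>u\<close> still makes the logarithmic term
      integrable.\<close>
    have pg_g: "poly_growth ?g"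
    proof (rule poly_growth_dominated[OF _ poly_growth_power[OF poly_growth_perturbation]])
      show "norm (?g z) \<le> norm (?u z ^ 4)" for z
        using g[of z] by (simp add: abs_of_nonneg) 
    qed measurable
    have ig: "integrable gauss_plane ?g" and ip: "integrable gauss_plane ?p"
      by (intro poly_growth_integrable pg_g pg_p)+
    have f: "(\<lambda>z. (1 + ?u z) * ln (1 + ?u z)) = (\<lambda>z. ?p z + ?g z)" by simp
    have "integrable gauss_plane (\<lambda>z. (1 + ?u z) * ln (1 + ?u z))"
      unfolding f using ig ip by (rule Bochner_Integration.integrable_add[rotated])
    moreover have "\<bar>(LINT z|gauss_plane. (1 + ?u z) * ln (1 + ?u z)) - (t\<^sup>2 + 2 ^ n * l\<^sup>2 * t\<^sup>2)\<bar> \<le> M * t ^ 4"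
    proof -
      have iu: "integrable gauss_plane (\<lambda>z. ?u z ^ k)" for k
        by (intro poly_growth_integrable poly_growth_power poly_growth_perturbation)
      have uk: "(LINT z|gauss_plane. ?u z ^ k) = t ^ k * (LINT z|gauss_plane. v t z ^ k)" for k
        by (simp add: u power_mult_distrib)
      have G: "0 \<le> integral\<^sup>L gauss_plane ?g" "integral\<^sup>L gauss_plane ?g \<le> t ^ 4 * (8 * (l ^ 4 * m 4 0 + m 0 4))"
      proof -
        show "0 \<le> integral\<^sup>L gauss_plane ?g" by (intro Bochner_Integration.integral_nonneg g(1))
        have "integral\<^sup>L gauss_plane ?g \<le> (LINT z|gauss_plane. ?u z ^ 4)"
        proof (rule integral_mono[OF ig iu])
          show "?g z \<le> ?u z ^ 4" for z using g[of z] zero_le_even_power[of 4 "?u z"] by simp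
        qed
        also have "\<dots> \<le> t ^ 4 * (8 * (l ^ 4 * m 4 0 + m 0 4))"
          unfolding uk using v4[OF t] by (intro mult_left_mono) auto
        finally show "integral\<^sup>L gauss_plane ?g \<le> t ^ 4 * (8 * (l ^ 4 * m 4 0 + m 0 4))" .
      qed
      have "integral\<^sup>L gauss_plane ?p = (LINT z|gauss_plane. ?u z ^ 1) + (LINT z|gauss_plane. ?u z ^ 2) / 2 - (LINT z|gauss_plane. ?u z ^ 3) / 6"
        using iu[of 1] iu[of 2] iu[of 3] by simp
      also have "\<dots> = t\<^sup>2 + 2 ^ n * l\<^sup>2 * t\<^sup>2
          + t ^ 4 * (m 0 2 / 2 - (3 * l\<^sup>2 * m 2 1 + 3 * l * t * m 1 2 + t\<^sup>2 * m 0 3) / 6)"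
        unfolding uk[of 2] uk[of 3] v2 v3
        using perturbation_mean[OF assms, of l t]
        by (simp add: power2_eq_square power3_eq_cube power4_eq_xxxx algebra_simps add_divide_distrib diff_divide_distrib)
      finally have P: "integral\<^sup>L gauss_plane ?p - (t\<^sup>2 + 2 ^ n * l\<^sup>2 * t\<^sup>2)
          = t ^ 4 * (m 0 2 / 2 - (3 * l\<^sup>2 * m 2 1 + 3 * l * t * m 1 2 + t\<^sup>2 * m 0 3) / 6)" by simp
      have b: "\<bar>m 0 2 / 2 - (3 * l\<^sup>2 * m 2 1 + 3 * l * t * m 1 2 + t\<^sup>2 * m 0 3) / 6\<bar>
          \<le> \<bar>m 0 2\<bar> + (3 * l\<^sup>2 * \<bar>m 2 1\<bar> + 3 * \<bar>l\<bar> * \<bar>m 1 2\<bar> + \<bar>m 0 3\<bar>)"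
      proof -
        have "\<bar>3 * l\<^sup>2 * m 2 1\<bar> = 3 * l\<^sup>2 * \<bar>m 2 1\<bar>" by (simp add: abs_mult)
        moreover have "\<bar>3 * l * t * m 1 2\<bar> \<le> 3 * \<bar>l\<bar> * \<bar>m 1 2\<bar>"
        proof -
          have "\<bar>t\<bar> * (3 * \<bar>l\<bar> * \<bar>m 1 2\<bar>) \<le> 1 * (3 * \<bar>l\<bar> * \<bar>m 1 2\<bar>)" using t by (intro mult_right_mono) auto
          then show ?thesis by (simp add: abs_mult mult_ac)
        qed
        moreover have "\<bar>t\<^sup>2 * m 0 3\<bar> \<le> \<bar>m 0 3\<bar>"
        proof -
          have "t\<^sup>2 \<le> 1" using t by (simp add: abs_square_le_1)
          then have "t\<^sup>2 * \<bar>m 0 3\<bar> \<le> 1 * \<bar>m 0 3\<bar>" by (intro mult_right_mono) auto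
          then show ?thesis by (simp add: abs_mult)
        qed
        moreover have "\<bar>a / 2 - (x + y + z) / 6\<bar> \<le> \<bar>a\<bar> + (x' + y' + z')"
          if "\<bar>x\<bar> = x'" "\<bar>y\<bar> \<le> y'" "\<bar>z\<bar> \<le> z'" for a x y z x' y' z' :: real
        proof -
          have "x \<le> x'" "- x \<le> x'" "y \<le> y'" "- y \<le> y'" "z \<le> z'" "- z \<le> z'"
            using that by auto
          moreover have "a \<le> \<bar>a\<bar>" "- a \<le> \<bar>a\<bar>" by auto
          ultimately show ?thesis by (intro abs_leI; argo)
        qed
        ultimately show ?thesis by blast
      qed
      have "(LINT z|gauss_plane. (1 + ?u z) * ln (1 + ?u z)) = integral\<^sup>L gauss_plane ?p + integral\<^sup>L gauss_plane ?g"
        unfolding f by (rule Bochner_Integration.integral_add[OF ip ig])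
      then have "\<bar>(LINT z|gauss_plane. (1 + ?u z) * ln (1 + ?u z)) - (t\<^sup>2 + 2 ^ n * l\<^sup>2 * t\<^sup>2)\<bar>
          \<le> \<bar>integral\<^sup>L gauss_plane ?p - (t\<^sup>2 + 2 ^ n * l\<^sup>2 * t\<^sup>2)\<bar> + integral\<^sup>L gauss_plane ?g"
        using G(1) by linarith
      also have "\<dots> \<le> t ^ 4 * (\<bar>m 0 2\<bar> + (3 * l\<^sup>2 * \<bar>m 2 1\<bar> + 3 * \<bar>l\<bar> * \<bar>m 1 2\<bar> + \<bar>m 0 3\<bar>))
          + t ^ 4 * (8 * (l ^ 4 * m 4 0 + m 0 4))"
        unfolding P abs_mult using b G(2) by (intro add_mono mult_mono) auto
      also have "\<dots> = M * t ^ 4" by (simp add: M_def algebra_simps)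
      finally show ?thesis .
    qed
    ultimately show "integrable gauss_plane (\<lambda>z. (1 + ?u z) * ln (1 + ?u z)) \<and>
      \<bar>(LINT z|gauss_plane. (1 + ?u z) * ln (1 + ?u z)) - (t\<^sup>2 + 2 ^ n * l\<^sup>2 * t\<^sup>2)\<bar> \<le> M * t ^ 4" ..
  qed
qed

text \<open>An exact identity. The logarithm of the Wigner function is -r^2 - ln pi - ln (1 + t^2) +
  ln (1 + u), so the entropy consists of an energy, a mass and a relative entropy; the energy
  exceeds the mass by 2n t^2.\<close>

lemma diff_entropy_sigma_state:
  assumes n: "1 \<le> n" and pos: "\<And>z. 0 < 1 + wigner_perturbation n l t z"
    and int: "integrable gauss_plane (\<lambda>z. (1 + wigner_perturbation n l t z) * ln (1 + wigner_perturbation n l t z))"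
  shows "diff_entropy (wigner (sigma_state n t l)) - (1 + ln pi)
    = (2 * real n * t\<^sup>2
       - (LINT z|gauss_plane. (1 + wigner_perturbation n l t z) * ln (1 + wigner_perturbation n l t z))) / (1 + t\<^sup>2)
      + ln (1 + t\<^sup>2)"
proof -
  let ?u = "wigner_perturbation n l t"
  define s where "s = 1 + t\<^sup>2"
  have s: "0 < s" by (simp add: s_def add_pos_nonneg)
  define F where "F = (\<lambda>z. ((1 + ?u z) * ln (1 + ?u z) - (1 + ?u z) * (norm z)\<^sup>2 - (ln pi + ln s) * (1 + ?u z)) / s)"
  have [measurable]: "?u \<in> borel_measurable borel" by (rule poly_growth_measurable) simp
  have Fm: "F \<in> borel_measurable borel" unfolding F_def by measurable
  have W: "wigner (sigma_state n t l) (fst z) (snd z) * ln (wigner (sigma_state n t l) (fst z) (snd z))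
      = (exp (- (norm z)\<^sup>2) / pi) *\<^sub>R F z" for z
  proof -
    have ln_eq: "ln (exp (- (norm z)\<^sup>2) / pi * ((1 + ?u z) / s)) = - (norm z)\<^sup>2 - ln pi + (ln (1 + ?u z) - ln s)"
      using pos[of z] s by (simp add: ln_mult ln_div)
    then show ?thesis
      unfolding wigner_sigma_state_perturbation s_def[symmetric] F_def
      using s by (simp only: real_scaleR_def ln_eq) (simp add: field_simps)
  qed
  have i1: "integrable gauss_plane (\<lambda>z. (1 + ?u z) * (norm z)\<^sup>2)"
    by (intro poly_growth_integrable poly_growth_mult poly_growth_add poly_growth_const poly_growth_power
        poly_growth_norm poly_growth_perturbation)
  have i2: "integrable gauss_plane ?u" "integrable gauss_plane (\<lambda>z. 1 :: real)"
    by (intro poly_growth_integrable poly_growth_perturbation poly_growth_const)+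
  have one: "(LINT z|gauss_plane. (1::real)) = 1" using norm_moment[of 0] by simp
  have mass: "(LINT z|gauss_plane. 1 + ?u z) = s"
    using i2 one perturbation_mean[OF n, of l t] by (simp add: s_def)
  have "diff_entropy (wigner (sigma_state n t l)) = - integral\<^sup>L gauss_plane F"
    unfolding diff_entropy_def W integral_gauss_plane[OF Fm] ..
  also have "integral\<^sup>L gauss_plane F = ((LINT z|gauss_plane. (1 + ?u z) * ln (1 + ?u z))
      - (LINT z|gauss_plane. (1 + ?u z) * (norm z)\<^sup>2) - (ln pi + ln s) * (LINT z|gauss_plane. 1 + ?u z)) / s"
  proof -
    have i3: "integrable gauss_plane (\<lambda>z. (ln pi + ln s) * (1 + ?u z))"
      using i2 by (intro integrable_mult_right Bochner_Integration.integrable_add)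
    show ?thesis
      unfolding F_def
      by (simp only: integral_divide_zero Bochner_Integration.integral_diff[OF Bochner_Integration.integrable_diff[OF int i1] i3]
          Bochner_Integration.integral_diff[OF int i1] integral_mult_right_zero)
  qed
  finally show ?thesis
    unfolding mass perturbation_energy[OF n] s_def[symmetric]
    using s by (simp add: field_simps) (simp add: s_def algebra_simps)
qed

lemma entropy_expansion:
  assumes n: "1 \<le> n" and l: "0 \<le> l" "l < 1"
  shows "(\<lambda>t. diff_entropy (wigner (sigma_state n t l)) - (1 + ln pi) - (2 * real n - 2 ^ n * l\<^sup>2) * t\<^sup>2)
    \<in> O[at 0](\<lambda>t. t ^ 4)"
proof -
  obtain t0 where t0: "0 < t0" "\<And>t z. \<bar>t\<bar> \<le> t0 \<Longrightarrow> 0 < 1 + wigner_perturbation n l t z"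
    using perturbation_positive[OF l, of n] by blast
  obtain M where M: "\<And>t. \<bar>t\<bar> \<le> 1 \<Longrightarrow> (\<forall>z. 0 < 1 + wigner_perturbation n l t z) \<Longrightarrow>
     integrable gauss_plane (\<lambda>z. (1 + wigner_perturbation n l t z) * ln (1 + wigner_perturbation n l t z)) \<and>
     \<bar>(LINT z|gauss_plane. (1 + wigner_perturbation n l t z) * ln (1 + wigner_perturbation n l t z))
        - (t\<^sup>2 + 2 ^ n * l\<^sup>2 * t\<^sup>2)\<bar> \<le> M * t ^ 4"
    using perturbation_relative_entropy[OF n, of l] by blast
  define a where "a = 2 * real n - 2 ^ n * l\<^sup>2"
  \<comment> \<open>The three constants come from replacing 1 / (1 + t^2) by 1, from the relative
    entropy, and from replacing ln (1 + t^2) by t^2.\<close>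
  have bound: "\<bar>diff_entropy (wigner (sigma_state n t l)) - (1 + ln pi) - a * t\<^sup>2\<bar> \<le> (\<bar>a - 1\<bar> + M + 1) * t ^ 4"
    if t: "\<bar>t\<bar> \<le> min t0 1" for t
  proof -
    define X where "X = (LINT z|gauss_plane. (1 + wigner_perturbation n l t z) * ln (1 + wigner_perturbation n l t z))"
    define Y where "Y = X - (t\<^sup>2 + 2 ^ n * l\<^sup>2 * t\<^sup>2)"
    define s where "s = 1 + t\<^sup>2"
    have s: "1 \<le> s" by (simp add: s_def)
    have pos: "\<forall>z. 0 < 1 + wigner_perturbation n l t z" using t0(2) t by auto
    have MM: "integrable gauss_plane (\<lambda>z. (1 + wigner_perturbation n l t z) * ln (1 + wigner_perturbation n l t z))"
      "\<bar>Y\<bar> \<le> M * t ^ 4"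
      using M[of t] t pos by (auto simp: X_def Y_def)
    have h: "diff_entropy (wigner (sigma_state n t l)) - (1 + ln pi) = (2 * real n * t\<^sup>2 - X) / s + ln s"
      unfolding X_def s_def using diff_entropy_sigma_state[OF n _ MM(1)] pos by blast
    have div_s: "\<bar>x / s\<bar> \<le> \<bar>x\<bar>" for x
      using s mult_left_mono[of 1 s "\<bar>x\<bar>"] by (simp add: abs_divide divide_le_eq)
    have "(2 * real n * t\<^sup>2 - X) / s + ln s - a * t\<^sup>2 = - ((a - 1) * t ^ 4 / s) - Y / s + (ln s - t\<^sup>2)"
    proof -
      \<comment> \<open>The mean t^2 contained in \<open>X\<close> lowers the coefficient to
        \<open>a - 1\<close>; the logarithm of \<open>s\<close> restores the missing t^2.\<close>
      have "2 * real n * t\<^sup>2 - X = (a - 1) * t\<^sup>2 - Y" by (simp add: Y_def a_def algebra_simps)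
      moreover have "(a - 1) * t\<^sup>2 / s = (a - 1) * t\<^sup>2 - (a - 1) * t ^ 4 / s"
      proof -
        have "(a - 1) * t\<^sup>2 * s - (a - 1) * t ^ 4 = (a - 1) * t\<^sup>2"
          by (simp add: s_def power2_eq_square power4_eq_xxxx algebra_simps)
        then show ?thesis using s by (simp add: field_simps)
      qed
      ultimately have "(2 * real n * t\<^sup>2 - X) / s = (a - 1) * t\<^sup>2 - (a - 1) * t ^ 4 / s - Y / s"
        by (simp only: diff_divide_distrib)
      then show ?thesis by (simp add: algebra_simps)
    qed
    moreover have "\<bar>(a - 1) * t ^ 4 / s\<bar> \<le> \<bar>a - 1\<bar> * t ^ 4"
      using div_s[of "(a - 1) * t ^ 4"] by (simp add: abs_mult)
    moreover have "\<bar>Y / s\<bar> \<le> M * t ^ 4"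
      using div_s[of Y] MM(2) by linarith
    moreover have "\<bar>ln s - t\<^sup>2\<bar> \<le> t ^ 4"
    proof -
      have "t\<^sup>2 \<le> 1" using t by (simp add: abs_square_le_1)
      from abs_ln_one_plus_x_minus_x_bound_nonneg[OF _ this] show ?thesis
        by (simp add: s_def)
    qed
    ultimately show ?thesis unfolding h distrib_right by linarith
  qed
  show ?thesis
  proof (rule bigoI)
    show "\<forall>\<^sub>F t in at 0. norm (diff_entropy (wigner (sigma_state n t l)) - (1 + ln pi) - (2 * real n - 2 ^ n * l\<^sup>2) * t\<^sup>2)
        \<le> (\<bar>a - 1\<bar> + M + 1) * norm (t ^ 4)"
      unfolding eventually_at using t0(1) bound
      by (intro exI[of _ "min t0 1"]) (auto simp: a_def)
  qed
qed

lemma wigner_sigma_state_positive: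
  assumes "0 \<le> l" "l < 1"
  shows "\<exists>t0>0. \<forall>t::real. \<bar>t\<bar> \<le> t0 \<longrightarrow> (\<forall>q p. wigner (sigma_state n t l) q p > 0)"
proof -
  obtain t0 where t0: "0 < t0" "\<And>t z. \<bar>t\<bar> \<le> t0 \<Longrightarrow> 0 < 1 + wigner_perturbation n l t z"
    using perturbation_positive[OF assms, of n] by blast
  have "wigner (sigma_state n t l) q p > 0" if "\<bar>t\<bar> \<le> t0" for t q p
  proof -
    have "0 < 1 + t\<^sup>2" by (simp add: add_pos_nonneg)
    then show ?thesis
      using wigner_sigma_state_perturbation[of n t l "(q, p)"] t0(2)[OF that, of "(q, p)"] by simp
  qed
  with t0(1) show ?thesis by blast
qed

lemma entropy_below_vacuum:
  assumes n: "3 \<le> n" and l: "sqrt (real n / 2 ^ (n - 1)) < l" "l < 1"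
  shows "\<forall>\<^sub>F t in at (0::real). (\<forall>q p. wigner (sigma_state n t l) q p > 0) \<and>
           diff_entropy (wigner (sigma_state n t l)) < 1 + ln pi"
proof -
  have l0: "0 \<le> l" using l(1) by (meson less_imp_le order_trans real_sqrt_ge_zero divide_nonneg_nonneg of_nat_0_le_iff zero_le_power zero_le_numeral)
  define a where "a = 2 * real n - 2 ^ n * l\<^sup>2"
  have a: "a < 0"
  proof -
    have "real n / 2 ^ (n - 1) < l\<^sup>2"
      using l(1) l0 by (simp add: real_sqrt_less_iff[of _ "l\<^sup>2", symmetric] del: real_sqrt_less_iff)
    then have "real n < l\<^sup>2 * 2 ^ (n - 1)" by (simp add: field_simps)
    moreover have "(2::real) ^ n = 2 * 2 ^ (n - 1)" using n by (cases n) auto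
    ultimately show ?thesis by (simp add: a_def mult.commute)
  qed
  obtain c where c: "c > 0" "\<forall>\<^sub>F t in at 0.
      norm (diff_entropy (wigner (sigma_state n t l)) - (1 + ln pi) - (2 * real n - 2 ^ n * l\<^sup>2) * t\<^sup>2) \<le> c * norm (t ^ 4)"
    using entropy_expansion[of n l] n l0 l(2) by (auto elim!: landau_o.bigE)
  obtain t0 where t0: "0 < t0" "\<And>t q p. \<bar>t\<bar> \<le> t0 \<Longrightarrow> wigner (sigma_state n t l) q p > 0"
    using wigner_sigma_state_positive[OF l0 l(2), of n] by blast
  \<comment> \<open>Under this condition the error \<open>c * t ^ 4\<close> is smaller than the gain
    \<open>- a * t^2\<close>, strictly so because \<open>t \<noteq> 0\<close>.\<close>
  have "\<forall>\<^sub>F t in at (0::real). c * t\<^sup>2 < - a"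
  proof (rule order_tendstoD(2))
    show "((\<lambda>t::real. c * t\<^sup>2) \<longlongrightarrow> c * 0\<^sup>2) (at 0)" by (intro tendsto_intros)
  qed (use a in simp)
  moreover have "\<forall>\<^sub>F t in at (0::real). \<bar>t\<bar> \<le> t0"
    unfolding eventually_at using t0(1) by (intro exI[of _ t0]) auto
  moreover have "\<forall>\<^sub>F t in at (0::real). t \<noteq> 0"
    by (rule eventually_neq_at_within)
  ultimately show ?thesis
    using c(2)
  proof eventually_elim
    case (elim t)
    have "c * t ^ 4 = (c * t\<^sup>2) * t\<^sup>2" by (simp add: power2_eq_square power4_eq_xxxx)
    also have "\<dots> < - a * t\<^sup>2" using elim by (intro mult_strict_right_mono) auto
    finally have "diff_entropy (wigner (sigma_state n t l)) < 1 + ln pi"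
      using elim(4) unfolding a_def[symmetric] by simp
    then show ?case using t0(2) elim by blast
  qed
qed

theorem theorem2:
  shows "(\<forall>(n::nat) (l::real). 1 \<le> n \<and> 0 \<le> l \<and> l < 1 \<longrightarrow>
            (\<exists>t0>0. \<forall>t::real. \<bar>t\<bar> \<le> t0 \<longrightarrow> (\<forall>q p. wigner (sigma_state n t l) q p > 0)) \<and>
            (\<lambda>t::real. diff_entropy (wigner (sigma_state n t l)) - (1 + ln pi)
                   - (2 * real n - 2 ^ n * l\<^sup>2) * t\<^sup>2) \<in> O[at 0](\<lambda>t. t ^ 4))
       \<and> (\<forall>(n::nat) (l::real). 3 \<le> n \<and> sqrt (real n / 2 ^ (n - 1)) < l \<and> l < 1 \<longrightarrow>
            (\<forall>\<^sub>F t in at (0::real).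
               (\<forall>q p. wigner (sigma_state n t l) q p > 0) \<and>
               diff_entropy (wigner (sigma_state n t l)) < 1 + ln pi))"
  using wigner_sigma_state_positive entropy_expansion entropy_below_vacuum by blast

end
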